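(* Let $p$ be an odd prime, $N_{p-2}$ the number of permutations of $p-2$ letters with an even number of ascents, $A=\frac{pB_{p-1}+1}{p}$ the Agoh–Giuga quotient, and $H'_{p-1}=1+\frac13+\dots+\frac1{p-2}$. Then the following are equivalent: (a) $p$ is a super Wieferich prime; (b) $(2N_{p-2})_0=1$ and $(2N_{p-2})_1+A\equiv2\pmod p$; (c) $(H'_{p-1})_0=(H'_{p-1})_1=0$.
   Context: A prime $p$ is called a super Wieferich prime if $q_p(2)=\frac{2^{p-1}-1}{p}\equiv0\pmod{p^2}$. For a $p$-adic integer $x$, write $x=\sum_{j\ge0}(x)_jp^j$ with digits $(x)_j\in\{0,\dots,p-1\}$. For a permutation $(i_1,\dots,i_n)$ of $\{1,\dots,n\}$, an ascent is an index $k$ with $i_{k+1}>i_k$. *)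

theory Defs
  imports
    "HOL-Computational_Algebra.Formal_Power_Series"
    "HOL-Computational_Algebra.Primes"
    "HOL-Combinatorics.Multiset_Permutations"
    "HOL-Number_Theory.Cong"
begin

(* All numbers considered are rational, so the p-adic integers that occur lie in the localization
   of the integers at p, i.e. the intersection of the rationals with the ring of p-adic integers. *)
definition p_integers :: "nat \<Rightarrow> rat set" where
  "p_integers p = {of_int a / of_int b | a b :: int. \<not> int p dvd b}"

definition padic_cong :: "nat \<Rightarrow> nat \<Rightarrow> rat \<Rightarrow> rat \<Rightarrow> bool" where
  "padic_cong p m x y \<longleftrightarrow> (\<exists>z\<in>p_integers p. x - y = of_nat m * z)"

(* The second condition is convergence of the series to x in the p-adic topology. *)
definition is_padic_expansion :: "nat \<Rightarrow> rat \<Rightarrow> (nat \<Rightarrow> nat) \<Rightarrow> bool" where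
  "is_padic_expansion p x d \<longleftrightarrow>
     (\<forall>j. d j \<in> {0..p - 1}) \<and>
     (\<forall>k. \<forall>\<^sub>F n in sequentially. padic_cong p (p ^ k) x (\<Sum>j<n. of_nat (d j) * of_nat p ^ j))"

(* Meaningful for x in p_integers p only, where the expansion exists and is unique
   (ex1_padic_expansion below). *)
definition padic_digit :: "nat \<Rightarrow> rat \<Rightarrow> nat \<Rightarrow> nat" where
  "padic_digit p x = (THE d. is_padic_expansion p x d)"

definition fermat_quotient :: "nat \<Rightarrow> nat \<Rightarrow> rat" where
  "fermat_quotient p a = (of_nat a ^ (p - 1) - 1) / of_nat p"

definition super_wieferich :: "nat \<Rightarrow> bool" where
  "super_wieferich p \<longleftrightarrow> prime p \<and> padic_cong p (p ^ 2) (fermat_quotient p 2) 0"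

(* List positions start at 0. *)
definition ascents :: "nat list \<Rightarrow> nat set" where
  "ascents xs = {k. Suc k < length xs \<and> xs ! Suc k > xs ! k}"

definition num_even_ascents :: "nat \<Rightarrow> nat" where
  "num_even_ascents n = card {xs \<in> permutations_of_set {1..n}. even (card (ascents xs))}"

(* Generating function X / (exp X - 1). *)
definition bernoulli :: "nat \<Rightarrow> rat" where
  "bernoulli n = fact n * fps_nth (fps_X / (fps_exp 1 - 1)) n"

definition agoh_giuga_quotient :: "nat \<Rightarrow> rat" where
  "agoh_giuga_quotient p = (of_nat p * bernoulli (p - 1) + 1) / of_nat p"

definition odd_harmonic :: "nat \<Rightarrow> rat" where
  "odd_harmonic n = (\<Sum>k | k \<in> {1..n} \<and> odd k. 1 / of_nat k)"

lemma p_integersI: "\<not> int p dvd b \<Longrightarrow> of_int a / of_int b \<in> p_integers p"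
  unfolding p_integers_def by blast

lemma of_int_in_p_integers:
  assumes "prime p" shows "of_int a \<in> p_integers p"
proof -
  have "\<not> int p dvd 1" using prime_gt_1_nat[OF assms] by auto
  from p_integersI[OF this, of a] show ?thesis by simp
qed

lemma p_integers_add:
  assumes p: "prime p" and x: "x \<in> p_integers p" and y: "y \<in> p_integers p"
  shows "x + y \<in> p_integers p"
proof -
  obtain a b where x: "x = of_int a / of_int b" and b: "\<not> int p dvd b"
    using x unfolding p_integers_def by blast
  obtain c d where y: "y = of_int c / of_int d" and d: "\<not> int p dvd d"
    using y unfolding p_integers_def by blast
  have "\<not> int p dvd b * d" using p b d by (simp add: prime_dvd_mult_iff)
  moreover have "x + y = of_int (a * d + c * b) / of_int (b * d)"
  proof -
    have "b \<noteq> 0" "d \<noteq> 0" using b d by auto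
    then show ?thesis by (simp add: x y add_frac_eq)
  qed
  ultimately show ?thesis using p_integersI by metis
qed

lemma p_integers_mult:
  assumes p: "prime p" and x: "x \<in> p_integers p" and y: "y \<in> p_integers p"
  shows "x * y \<in> p_integers p"
proof -
  obtain a b where x: "x = of_int a / of_int b" and b: "\<not> int p dvd b"
    using x unfolding p_integers_def by blast
  obtain c d where y: "y = of_int c / of_int d" and d: "\<not> int p dvd d"
    using y unfolding p_integers_def by blast
  have "\<not> int p dvd b * d" using p b d by (simp add: prime_dvd_mult_iff)
  moreover have "x * y = of_int (a * c) / of_int (b * d)" by (simp add: x y)
  ultimately show ?thesis using p_integersI by metis
qed

lemma padic_cong_of_int_iff:
  assumes p: "prime p"
  shows "padic_cong p (p ^ k) (of_int u) (of_int v) \<longleftrightarrow> [u = v] (mod int p ^ k)"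
proof
  assume "padic_cong p (p ^ k) (of_int u) (of_int v)"
  then obtain a b where ab: "of_int u - of_int v = (of_nat (p ^ k) * (of_int a / of_int b) :: rat)"
    and b: "\<not> int p dvd b" unfolding padic_cong_def p_integers_def by blast
  have "b \<noteq> 0" using b by auto
  then have "of_int ((u - v) * b) = (of_int (int p ^ k * a) :: rat)"
    using ab by (simp add: field_simps)
  then have "(u - v) * b = int p ^ k * a" by (simp only: of_int_eq_iff)
  then have "int p ^ k dvd (u - v) * b" by simp
  moreover have "coprime (int p ^ k) b"
    using p b by (simp add: prime_imp_coprime)
  ultimately have "int p ^ k dvd u - v" by (simp add: coprime_dvd_mult_left_iff)
  then show "[u = v] (mod int p ^ k)" by (simp add: cong_iff_dvd_diff)
next
  assume "[u = v] (mod int p ^ k)"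
  then obtain c where "u - v = int p ^ k * c" by (auto simp: cong_iff_dvd_diff)
  then have "of_int (u - v) = (of_int (int p ^ k * c) :: rat)" by simp
  then have "of_int u - of_int v = (of_nat (p ^ k) * of_int c :: rat)" by simp
  then show "padic_cong p (p ^ k) (of_int u) (of_int v)"
    unfolding padic_cong_def using of_int_in_p_integers[OF p] by blast
qed

lemma padic_cong_sym:
  assumes p: "prime p" and "padic_cong p m x y" shows "padic_cong p m y x"
proof -
  obtain z where z: "z \<in> p_integers p" "x - y = of_nat m * z"
    using assms(2) unfolding padic_cong_def by blast
  have "- z \<in> p_integers p"
    using p_integers_mult[OF p of_int_in_p_integers[OF p, of "-1"] z(1)] by simp
  moreover have "y - x = of_nat m * (- z)" using z(2) by (simp add: algebra_simps)
  ultimately show ?thesis unfolding padic_cong_def by blast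
qed

lemma padic_cong_trans:
  assumes p: "prime p" and "padic_cong p m x y" and "padic_cong p m y w"
  shows "padic_cong p m x w"
proof -
  obtain z where z: "z \<in> p_integers p" "x - y = of_nat m * z"
    using assms(2) unfolding padic_cong_def by blast
  obtain z' where z': "z' \<in> p_integers p" "y - w = of_nat m * z'"
    using assms(3) unfolding padic_cong_def by blast
  have "x - w = of_nat m * (z + z')" using z(2) z'(2) by (simp add: algebra_simps)
  then show ?thesis unfolding padic_cong_def using p_integers_add[OF p z(1) z'(1)] by blast
qed

lemma padic_cong_power_le:
  assumes p: "prime p" and "padic_cong p (p ^ n) x y" and "k \<le> n"
  shows "padic_cong p (p ^ k) x y"
proof -
  obtain z where z: "z \<in> p_integers p" "x - y = of_nat (p ^ n) * z"
    using assms(2) unfolding padic_cong_def by blast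
  have "p ^ n = p ^ k * p ^ (n - k)" using assms(3) by (simp flip: power_add)
  then have "x - y = of_nat (p ^ k) * (of_int (int p ^ (n - k)) * z)"
    using z(2) by (simp add: algebra_simps)
  then show ?thesis unfolding padic_cong_def
    using p_integers_mult[OF p of_int_in_p_integers[OF p] z(1)] by blast
qed

lemma digit_sum_less:
  fixes d :: "nat \<Rightarrow> nat"
  assumes "\<And>j. d j < p" shows "(\<Sum>j<n. d j * p ^ j) < p ^ n"
proof (induction n)
  case (Suc n)
  have "(\<Sum>j<Suc n. d j * p ^ j) < p ^ n + d n * p ^ n" using Suc by simp
  also have "\<dots> = Suc (d n) * p ^ n" by simp
  also have "\<dots> \<le> p * p ^ n" using assms[of n] by (intro mult_right_mono) auto
  finally show ?case by simp
qed simp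

lemma digit_sum_mod:
  fixes d :: "nat \<Rightarrow> nat"
  assumes "\<And>j. d j < p" "n \<le> m" shows "(\<Sum>j<m. d j * p ^ j) mod p ^ n = (\<Sum>j<n. d j * p ^ j)"
proof -
  have "(\<Sum>j<m. d j * p ^ j) = (\<Sum>j<n. d j * p ^ j) + (\<Sum>j\<in>{n..<m}. d j * p ^ j)"
    using assms(2) by (subst sum.union_disjoint [symmetric]) (auto intro: sum.cong)
  moreover have "p ^ n dvd (\<Sum>j\<in>{n..<m}. d j * p ^ j)"
    by (intro dvd_sum) (auto intro!: dvd_mult le_imp_power_dvd)
  ultimately show ?thesis using digit_sum_less[of d p n] assms(1) by (auto elim!: dvdE)
qed

lemma padic_expansion_iff:
  assumes p: "prime p"
  shows "is_padic_expansion p x d \<longleftrightarrow> (\<forall>j. d j < p) \<and>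
    (\<forall>n. padic_cong p (p ^ n) x (of_nat (\<Sum>j<n. d j * p ^ j)))" (is "?L \<longleftrightarrow> ?R")
proof
  assume L: ?L
  then have d: "d j < p" for j
    using prime_gt_0_nat[OF p] unfolding is_padic_expansion_def
    by (metis atLeastAtMost_iff Suc_pred' less_Suc_eq_le)
  moreover have "padic_cong p (p ^ k) x (of_nat (\<Sum>j<k. d j * p ^ j))" for k
  proof -
    have "\<forall>\<^sub>F n in sequentially. n \<ge> k \<and>
        padic_cong p (p ^ k) x (\<Sum>j<n. of_nat (d j) * of_nat p ^ j)"
      using L unfolding is_padic_expansion_def by (intro eventually_conj eventually_ge_at_top) auto
    then obtain n where n: "n \<ge> k" "padic_cong p (p ^ k) x (\<Sum>j<n. of_nat (d j) * of_nat p ^ j)"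
      using eventually_happens'[OF sequentially_bot] by blast
    have "[(\<Sum>j<n. d j * p ^ j) = (\<Sum>j<k. d j * p ^ j)] (mod p ^ k)"
      using digit_sum_mod[of d p k n] digit_sum_mod[of d p k k] d n(1) by (simp add: cong_def)
    then have "[int (\<Sum>j<n. d j * p ^ j) = int (\<Sum>j<k. d j * p ^ j)] (mod int p ^ k)"
      by (metis cong_int_iff of_nat_power)
    from iffD2[OF padic_cong_of_int_iff[OF p] this] show ?thesis
      using padic_cong_trans[OF p n(2)] by simp
  qed
  ultimately show ?R by blast
next
  assume R: ?R
  have "padic_cong p (p ^ k) x (\<Sum>j<n. of_nat (d j) * of_nat p ^ j)" if "n \<ge> k" for n k
    using padic_cong_power_le[OF p _ that] R by simp
  moreover have "d j \<in> {0..p - 1}" for j using R[THEN conjunct1, rule_format, of j] by auto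
  ultimately show ?L
    unfolding is_padic_expansion_def eventually_sequentially by blast
qed

lemma ex1_padic_expansion:
  assumes p: "prime p" and x: "x \<in> p_integers p"
  shows "\<exists>!d. is_padic_expansion p x d"
proof (rule ex_ex1I)
  have p0: "p > 0" using p by (simp add: prime_gt_0_nat)
  obtain a b where x: "x = of_int a / of_int b" and b: "\<not> int p dvd b"
    using x unfolding p_integers_def by blast
  have b0: "b \<noteq> 0" using b by auto
  have "\<exists>r. r < p ^ n \<and> padic_cong p (p ^ n) x (of_nat r)" for n
  proof -
    have "coprime (int p ^ n) b" using p b by (simp add: prime_imp_coprime)
    then have "coprime b (int p ^ n)" by (simp only: coprime_commute)
    then obtain c where c: "[b * c = 1] (mod int p ^ n)"
      using cong_solve_coprime_int by blast
    define r where "r = nat ((a * c) mod int p ^ n)"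
    have r: "int r = (a * c) mod int p ^ n" using p0 by (simp add: r_def)
    have "[b * int r = b * (a * c)] (mod int p ^ n)" unfolding r by (simp add: cong_def mod_mult_right_eq)
    also have "b * (a * c) = a * (b * c)" by simp
    also have "[a * (b * c) = a * 1] (mod int p ^ n)" using c by (rule cong_scalar_left)
    finally have "[a = b * int r] (mod int p ^ n)" by (simp add: cong_sym)
    then obtain e where "a - b * int r = int p ^ n * e" by (auto simp: cong_iff_dvd_diff)
    then have "of_int (a - b * int r) = (of_int (int p ^ n * e) :: rat)" by simp
    then have "x - of_nat r = of_nat (p ^ n) * (of_int e / of_int b)"
      using b0 by (simp add: x field_simps)
    then have "padic_cong p (p ^ n) x (of_nat r)"
      unfolding padic_cong_def using p_integersI[OF b] by blast
    moreover have "int r < int (p ^ n)" using p0 by (simp add: r)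
    ultimately show ?thesis by auto
  qed
  then obtain r where r: "\<And>n. r n < p ^ n" "\<And>n. padic_cong p (p ^ n) x (of_nat (r n))"
    by metis
  have step: "r (Suc n) mod p ^ n = r n" for n
  proof -
    have "padic_cong p (p ^ n) (of_nat (r (Suc n))) (of_nat (r n))"
      using padic_cong_trans[OF p padic_cong_sym[OF p] r(2)]
        padic_cong_power_le[OF p r(2)[of "Suc n"], of n] by simp
    then have "[int (r (Suc n)) = int (r n)] (mod int p ^ n)"
      using padic_cong_of_int_iff[OF p] by (metis of_int_of_nat_eq)
    then have "[r (Suc n) = r n] (mod p ^ n)" by (metis cong_int_iff of_nat_power)
    then show ?thesis using r(1)[of n] by (simp add: cong_def)
  qed
  define d where "d j = r (Suc j) div p ^ j" for j
  have "(\<Sum>j<n. d j * p ^ j) = r n" for n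
  proof (induction n)
    case 0 then show ?case using r(1)[of 0] by simp
  next
    case (Suc n)
    then show ?case using div_mult_mod_eq[of "r (Suc n)" "p ^ n"]
      by (simp add: step d_def)
  qed
  moreover have "d j < p" for j
    using r(1)[of "Suc j"] by (simp add: d_def less_mult_imp_div_less)
  ultimately show "\<exists>d. is_padic_expansion p x d"
    unfolding padic_expansion_iff[OF p] using r(2) by metis
next
  fix d d' assume d: "is_padic_expansion p x d" and d': "is_padic_expansion p x d'"
  have p0: "p > 0" using p by (simp add: prime_gt_0_nat)
  note d = d[unfolded padic_expansion_iff[OF p]] and d' = d'[unfolded padic_expansion_iff[OF p]]
  have eq: "(\<Sum>j<n. d j * p ^ j) = (\<Sum>j<n. d' j * p ^ j)" for n
  proof -
    have "padic_cong p (p ^ n) (of_nat (\<Sum>j<n. d j * p ^ j)) (of_nat (\<Sum>j<n. d' j * p ^ j))"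
      using padic_cong_trans[OF p padic_cong_sym[OF p]] d d' by blast
    then have "[int (\<Sum>j<n. d j * p ^ j) = int (\<Sum>j<n. d' j * p ^ j)] (mod int p ^ n)"
      using padic_cong_of_int_iff[OF p] by (metis of_int_of_nat_eq)
    then have "[(\<Sum>j<n. d j * p ^ j) = (\<Sum>j<n. d' j * p ^ j)] (mod p ^ n)"
      by (metis cong_int_iff of_nat_power)
    then show ?thesis using digit_sum_less[of d p n] digit_sum_less[of d' p n] d d'
      by (simp add: cong_less_modulus_unique_nat)
  qed
  show "d = d'"
  proof
    fix j show "d j = d' j" using eq[of j] eq[of "Suc j"] p0 by simp
  qed
qed

end

theory Submission
  imports Defs "HOL-Number_Theory.Number_Theory"
begin

text \<open>Let T = -exp X, so that T' = T. Inserting the largest letter gives a recurrence for the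
  Eulerian polynomials S that is exactly the one for the iterated derivatives
  T S(T) / (1 - T)^(n+1) of 1 / (1 - T) = 1 / (1 + exp X). As X / (exp X + 1) is the difference of
  the Bernoulli generating functions at X and 2X, this evaluates S(-1), and 2 N = n! + S(-1)
  becomes an expression in Bernoulli numbers. Together with Glaisher's congruence
  (p - 1)! = p (A - 1) - 1 modulo p^2 one gets, with q the Fermat quotient of 2,
  2 N = 1 + p (2 - A) + q (1 + p (1 - A + q)) modulo p^2, and the last factor is a unit.

  For the harmonic sum put p = 2m + 1. Comparing the products of j (p - j) and of 2j (p - 2j) for
  j = 1, ..., m, which both equal (p - 1)!, expresses 2^(p-1) as a quotient of products that
  expand in powers of p; for p > 3 and modulo p^2 this makes q a unit times half the harmonic number of m,
  while Wolstenholme's theorem makes the odd harmonic sum minus the same half.\<close>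

subsection \<open>Ascents and Eulerian polynomials\<close>

text \<open>Recursive counterpart of \<open>card (ascents xs)\<close>, suited to induction over the
  list; \<open>card_ascents\<close> links the two.\<close>

fun num_ascents :: "nat list \<Rightarrow> nat" where
  "num_ascents (x # y # xs) = (if x < y then 1 else 0) + num_ascents (y # xs)"
| "num_ascents xs = 0"

lemma ascents_Cons_Cons:
  "ascents (x # y # xs) = (if x < y then {0} else {}) \<union> Suc ` ascents (y # xs)"
proof (rule Set.set_eqI)
  fix k
  show "k \<in> ascents (x # y # xs) \<longleftrightarrow> k \<in> (if x < y then {0} else {}) \<union> Suc ` ascents (y # xs)"
    by (cases k) (auto simp: ascents_def)
qed

lemma finite_ascents: "finite (ascents xs)"
  by (rule finite_subset[of _ "{..length xs}"]) (auto simp: ascents_def)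

lemma card_ascents: "card (ascents xs) = num_ascents xs"
proof (induction xs rule: num_ascents.induct)
  case (1 x y xs)
  have "card (ascents (x # y # xs)) = card (if x < y then {0::nat} else {}) + card (Suc ` ascents (y # xs))"
    unfolding ascents_Cons_Cons by (intro card_Un_disjoint) (auto simp: finite_ascents)
  then show ?case using 1 by (simp add: card_image)
qed (auto simp: ascents_def)

definition insert_at :: "nat \<Rightarrow> 'a \<Rightarrow> 'a list \<Rightarrow> 'a list" where
  "insert_at i x xs = take i xs @ x # drop i xs"

lemma insert_at_0: "insert_at 0 x xs = x # xs"
  by (simp add: insert_at_def)

lemma insert_at_Suc: "insert_at (Suc i) x (y # xs) = y # insert_at i x xs"
  by (simp add: insert_at_def)

text \<open>A letter \<open>m\<close> above all others, put into a gap between two letters that form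
  an ascent, leaves the number of ascents unchanged; put into a descent or at the end, it adds one.
  The front position is left out so that the head of the list survives each insertion, which the
  induction needs.\<close>

lemma sum_insert_at_Suc:
  fixes t :: "'a :: comm_ring_1"
  assumes "\<forall>x\<in>set xs. x < m"
  shows "(\<Sum>i<length xs. t ^ num_ascents (insert_at (Suc i) m xs)) =
           of_nat (num_ascents xs) * t ^ num_ascents xs
           + (of_nat (length xs) - of_nat (num_ascents xs)) * t ^ Suc (num_ascents xs)"
  using assms
proof (induction xs rule: num_ascents.induct)
  case (1 x y xs)
  define c :: nat where "c = (if x < y then 1 else 0)"
  define a where "a = num_ascents (y # xs)"
  \<comment> \<open>The gap between \<open>x\<close> and \<open>y\<close> always gives
    \<open>Suc a\<close>, since \<open>x < m\<close> is an ascent and \<open>m\<close>,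
    \<open>y\<close> is none. Every later gap leaves \<open>x\<close>, \<open>y\<close> adjacent, so
    their comparison contributes the common factor \<open>t ^ c\<close>.\<close>
  have "(\<Sum>i<length (x # y # xs). t ^ num_ascents (insert_at (Suc i) m (x # y # xs))) =
    t ^ Suc a + t ^ c * (\<Sum>i<length (y # xs). t ^ num_ascents (insert_at (Suc i) m (y # xs)))"
    unfolding sum_distrib_left using 1(2)
    by (simp add: sum.lessThan_Suc_shift insert_at_0 insert_at_Suc a_def c_def power_add
        del: sum.lessThan_Suc power_Suc flip: power_Suc)
  also have "\<dots> = t ^ Suc a + t ^ c * (of_nat a * t ^ a + (of_nat (length (y # xs)) - of_nat a) * t ^ Suc a)"
    using 1 by (simp add: a_def)
  also have "\<dots> = of_nat (c + a) * t ^ (c + a)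
           + (of_nat (length (x # y # xs)) - of_nat (c + a)) * t ^ Suc (c + a)"
    by (cases "x < y") (simp_all add: c_def algebra_simps)
  finally show ?case by (simp add: a_def c_def)
qed (auto simp: insert_at_def)

lemma sum_insert_at:
  fixes t :: "'a :: comm_ring_1"
  assumes "\<forall>x\<in>set xs. x < m"
  shows "(\<Sum>i\<le>length xs. t ^ num_ascents (insert_at i m xs)) =
           (of_nat (num_ascents xs) + 1) * t ^ num_ascents xs
           + (of_nat (length xs) - of_nat (num_ascents xs)) * t ^ Suc (num_ascents xs)"
proof -
  \<comment> \<open>In front, the largest letter creates at most a descent.\<close>
  have "num_ascents (m # xs) = num_ascents xs"
    using assms by (cases xs) auto
  then show ?thesis
    by (simp add: sum.atMost_shift sum_insert_at_Suc[OF assms] insert_at_0 algebra_simps)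
qed

text \<open>The inverse deletes \<open>x\<close> and recovers its position as the length of the
  prefix before it.\<close>

lemma bij_betw_insert_at:
  assumes "finite A" "x \<notin> A"
  shows "bij_betw (\<lambda>(xs, i). insert_at i x xs) (permutations_of_set A \<times> {..card A})
           (permutations_of_set (insert x A))"
proof (rule bij_betwI[where g = "\<lambda>ys. (remove1 x ys, length (takeWhile (\<lambda>y. y \<noteq> x) ys))"])
  show "(\<lambda>(xs, i). insert_at i x xs) \<in> permutations_of_set A \<times> {..card A} \<rightarrow> permutations_of_set (insert x A)"
  proof safe
    fix xs i assume "xs \<in> permutations_of_set A"
    then have xs: "set xs = A" "distinct xs" by (auto simp: permutations_of_set_def)
    have "mset (insert_at i x xs) = mset (x # xs)"
      by (simp add: insert_at_def flip: mset_append[of "take i xs" "drop i xs"])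
    then show "insert_at i x xs \<in> permutations_of_set (insert x A)"
      using xs assms(2)
      by (metis distinct.simps(2) list.simps(15) mset_eq_imp_distinct_iff mset_eq_setD permutations_of_setI)
  qed
  show "(\<lambda>ys. (remove1 x ys, length (takeWhile (\<lambda>y. y \<noteq> x) ys)))
      \<in> permutations_of_set (insert x A) \<rightarrow> permutations_of_set A \<times> {..card A}"
  proof safe
    fix ys assume "ys \<in> permutations_of_set (insert x A)"
    then have ys: "set ys = insert x A" "distinct ys" by (auto simp: permutations_of_set_def)
    then show "remove1 x ys \<in> permutations_of_set A"
      using assms(2) by (auto simp: permutations_of_set_def set_remove1_eq)
    obtain us vs where "ys = us @ x # vs" "x \<notin> set us"
      using ys(1) by (metis insertI1 split_list_first)
    then have "length (takeWhile (\<lambda>y. y \<noteq> x) ys) < length ys"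
      by (auto simp: takeWhile_append)
    also have "length ys = Suc (card A)"
      using ys assms by (metis card_insert_disjoint distinct_card)
    finally show "length (takeWhile (\<lambda>y. y \<noteq> x) ys) \<le> card A" by simp
  qed
next
  fix z assume "z \<in> permutations_of_set A \<times> {..card A}"
  then obtain xs i where z: "z = (xs, i)" "set xs = A" "distinct xs" "i \<le> length xs"
    by (auto simp: permutations_of_set_def distinct_card)
  have "x \<notin> set (take i xs)" "x \<notin> set xs" using z(2) assms(2) by (auto dest: in_set_takeD)
  moreover from this have "takeWhile (\<lambda>y. y \<noteq> x) (take i xs @ x # drop i xs) = take i xs"
    by (subst takeWhile_append2) auto
  ultimately show "(\<lambda>ys. (remove1 x ys, length (takeWhile (\<lambda>y. y \<noteq> x) ys))) ((\<lambda>(xs, i). insert_at i x xs) z) = z"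
    using z by (simp add: insert_at_def remove1_append)
next
  fix ys assume "ys \<in> permutations_of_set (insert x A)"
  then have ys: "x \<in> set ys" "distinct ys" by (auto simp: permutations_of_set_def)
  then obtain us vs where "ys = us @ x # vs" "x \<notin> set us" by (meson split_list_first)
  moreover from this have "takeWhile (\<lambda>y. y \<noteq> x) ys = us"
    by (auto simp: takeWhile_append)
  ultimately show "(\<lambda>(xs, i). insert_at i x xs) (remove1 x ys, length (takeWhile (\<lambda>y. y \<noteq> x) ys)) = ys"
    by (simp add: insert_at_def remove1_append)
qed

text \<open>The Eulerian polynomial as a function on any commutative ring, because it is evaluated
  both at the power series \<open>- fps_exp 1\<close> and at the number -1.\<close>

definition eulerian :: "nat \<Rightarrow> 'a :: comm_ring_1 \<Rightarrow> 'a" where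
  "eulerian n t = (\<Sum>xs\<in>permutations_of_set {1..n}. t ^ num_ascents xs)"

text \<open>Every permutation of n + 1 letters arises once by inserting the largest letter. The
  remaining sum is t times the derivative of the polynomial in t; written as a sum it makes sense
  for a value \<open>t\<close> in any ring, and for a power series with T' = T it is the derivative
  by \<open>fps_deriv_eulerian\<close>.\<close>

lemma eulerian_Suc:
  "eulerian (Suc n) t = (1 + of_nat n * t) * eulerian n t
     + (1 - t) * (\<Sum>xs\<in>permutations_of_set {1..n}. of_nat (num_ascents xs) * t ^ num_ascents xs)"
proof -
  have eq: "{1..Suc n} = insert (Suc n) {1..n}" by auto
  have "eulerian (Suc n) t = (\<Sum>(xs, i)\<in>permutations_of_set {1..n} \<times> {..n}. t ^ num_ascents (insert_at i (Suc n) xs))"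
    unfolding eulerian_def eq
    by (subst sum.reindex_bij_betw[OF bij_betw_insert_at, symmetric]) (auto simp: case_prod_unfold)
  also have "\<dots> = (\<Sum>xs\<in>permutations_of_set {1..n}. \<Sum>i\<le>n. t ^ num_ascents (insert_at i (Suc n) xs))"
    by (simp add: sum.cartesian_product)
  also have "\<dots> = (\<Sum>xs\<in>permutations_of_set {1..n}.
      (of_nat (num_ascents xs) + 1) * t ^ num_ascents xs
           + (of_nat n - of_nat (num_ascents xs)) * t ^ Suc (num_ascents xs))"
  proof (rule sum.cong)
    fix xs assume "xs \<in> permutations_of_set {1..n}"
    then have "\<forall>x\<in>set xs. x < Suc n" "length xs = n"
      by (auto simp: permutations_of_set_def dest: distinct_card)
    then show "(\<Sum>i\<le>n. t ^ num_ascents (insert_at i (Suc n) xs)) = (of_nat (num_ascents xs) + 1) * t ^ num_ascents xs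
           + (of_nat n - of_nat (num_ascents xs)) * t ^ Suc (num_ascents xs)"
      using sum_insert_at[of xs "Suc n" t] by simp
  qed simp
  also have "\<dots> = (\<Sum>xs\<in>permutations_of_set {1..n}. (1 + of_nat n * t) * t ^ num_ascents xs
      + (1 - t) * (of_nat (num_ascents xs) * t ^ num_ascents xs))"
    by (intro sum.cong) (simp_all add: algebra_simps)
  finally show ?thesis
    by (simp add: eulerian_def sum.distrib flip: sum_distrib_left)
qed

text \<open>The summand 1 + (-1)^k is 2 for even k and 0 for odd k, so adding the signed count to
  the plain count doubles the even part.\<close>

lemma two_num_even_ascents:
  "(of_nat (2 * num_even_ascents n) :: 'a :: {comm_ring_1, semiring_char_0}) = fact n + eulerian n (- 1)"
proof -
  let ?P = "permutations_of_set {1..n}"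
  have "fact n + eulerian n (- 1) = (\<Sum>xs\<in>?P. 1 + (- 1) ^ num_ascents xs :: 'a)"
    by (simp add: eulerian_def sum.distrib)
  also have "\<dots> = (\<Sum>xs\<in>?P. if even (num_ascents xs) then 2 else 0)"
    by (intro sum.cong) auto
  also have "\<dots> = (\<Sum>xs\<in>{xs \<in> ?P. even (num_ascents xs)}. 2)"
    by (intro sum.inter_filter[symmetric]) simp
  finally show ?thesis
    by (simp add: num_even_ascents_def card_ascents mult.commute)
qed

section \<open>Derivatives of 1 / (1 + exp X) and Bernoulli numbers\<close>

lemma eulerian_0: "eulerian 0 t = 1"
  by (simp add: eulerian_def)

lemma fps_deriv_eulerian:
  fixes t :: "rat fps"
  assumes "fps_deriv t = t"
  shows "fps_deriv (eulerian n t) =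
    (\<Sum>xs\<in>permutations_of_set {1..n}. of_nat (num_ascents xs) * t ^ num_ascents xs)"
proof -
  have "fps_deriv (t ^ k) = of_nat k * t ^ k" for k
    by (induction k) (simp_all add: assms algebra_simps)
  then show ?thesis by (simp add: eulerian_def fps_deriv_sum)
qed

text \<open>Induction with g' = t g^2: differentiating the right-hand side reproduces the recurrence
  \<open>eulerian_Suc\<close>. The formula starts at the first derivative, as \<open>g\<close>
  itself lacks the factor \<open>t\<close>.\<close>

lemma fps_nth_deriv_eulerian:
  fixes t g :: "rat fps"
  assumes t: "fps_deriv t = t" and g: "g * (1 - t) = 1"
  shows "fps_nth_deriv (Suc n) g = t * eulerian (Suc n) t * g ^ (n + 2)"
proof -
  have "fps_deriv g * (1 - t) - g * t = fps_deriv (g * (1 - t))"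
    by (simp add: t algebra_simps)
  then have "fps_deriv g * (1 - t) = g * t" using g by simp
  then have "fps_deriv g * (g * (1 - t)) = g * t * g" by (metis mult.assoc mult.commute)
  then have dg: "fps_deriv g = t * g ^ 2" using g by (simp add: power2_eq_square mult.commute mult.left_commute)
  have dgk: "fps_deriv (g ^ k) = of_nat k * t * g ^ Suc k" for k
    by (induction k) (simp_all add: dg power2_eq_square algebra_simps)
  have "fps_nth_deriv n (fps_deriv g) = t * eulerian (Suc n) t * g ^ (n + 2)"
  proof (induction n)
    case 0
    show ?case by (simp add: dg eulerian_Suc eulerian_0 numeral_2_eq_2)
  next
    case (Suc n)
    let ?E = "eulerian (Suc n) t" and ?E' = "fps_deriv (eulerian (Suc n) t)"
    have "fps_nth_deriv (Suc n) (fps_deriv g) = fps_deriv (fps_nth_deriv n (fps_deriv g))"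
      by (simp only: fps_nth_deriv_commute fps_nth_deriv.simps)
    also have "\<dots> = fps_deriv (t * ?E * g ^ (n + 2))" by (simp only: Suc)
    also have "\<dots> = t * ?E * (of_nat (n + 2) * t * g ^ (n + 3)) + t * (?E + ?E') * g ^ (n + 2)"
      by (simp add: dgk t algebra_simps del: power_Suc of_nat_add) (simp add: eval_nat_numeral)
    \<comment> \<open>Raising the exponent of \<open>g\<close> produces the factor
      \<open>1 - t\<close> that stands before the derivative in the recurrence.\<close>
    also have "g ^ (n + 2) = g ^ (n + 3) * (1 - t)"
      using g by (simp add: numeral_3_eq_3 numeral_2_eq_2 mult_ac)
    also have "t * ?E * (of_nat (n + 2) * t * g ^ (n + 3)) + t * (?E + ?E') * (g ^ (n + 3) * (1 - t))
       = t * ((1 + of_nat (Suc n) * t) * ?E + (1 - t) * ?E') * g ^ (n + 3)"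
      by (simp add: algebra_simps)
    also have "(1 + of_nat (Suc n) * t) * ?E + (1 - t) * ?E' = eulerian (Suc (Suc n)) t"
      by (simp only: eulerian_Suc[of "Suc n"] fps_deriv_eulerian[OF t])
    finally show ?case by (simp add: eval_nat_numeral)
  qed
  then show ?thesis by simp
qed

text \<open>The denominator is not invertible, but it has subdegree 1 like X, so the quotient is
  exact. The generating function is handled through this product.\<close>

lemma bernoulli_fps: "fps_X / (fps_exp 1 - 1) * (fps_exp 1 - 1) = (fps_X :: rat fps)"
proof -
  have "subdegree (fps_exp 1 - 1 :: rat fps) = 1"
    by (intro subdegreeI) auto
  then have "fps_exp 1 - 1 dvd (fps_X :: rat fps)"
    by (subst fps_dvd_iff) (auto dest: arg_cong[where f = subdegree])
  then show ?thesis by simp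
qed

lemma fps_nth_eulerian_0:
  fixes t :: "rat fps"
  shows "fps_nth (eulerian n t) 0 = eulerian n (fps_nth t 0)"
  by (simp add: eulerian_def fps_sum_nth fps_nth_power_0)

lemma eulerian_minus_1:
  "eulerian (Suc n) (- 1 :: rat) = 2 ^ (n + 2) * (2 ^ (n + 2) - 1) * bernoulli (n + 2) / of_nat (n + 2)"
proof -
  define b :: "rat fps" where "b = fps_X / (fps_exp 1 - 1)"
  define b2 where "b2 = b oo (fps_const 2 * fps_X)"
  define g :: "rat fps" where "g = inverse (1 + fps_exp 1)"
  have g: "g * (1 + fps_exp 1) = 1" unfolding g_def by (intro inverse_mult_eq_1) simp
  have b: "b * (fps_exp 1 - 1) = fps_X" unfolding b_def by (rule bernoulli_fps)
  have "(b * (fps_exp 1 - 1)) oo (fps_const 2 * fps_X) = b2 * (fps_exp 2 - 1)"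
    unfolding b2_def
    by (subst fps_compose_mult_distrib) (simp_all add: fps_compose_sub_distrib)
  then have b2: "b2 * (fps_exp 2 - 1) = fps_const 2 * fps_X" by (simp add: b)
  have ee: "fps_exp 1 * fps_exp 1 = (fps_exp 2 :: rat fps)"
    by (simp flip: fps_exp_add_mult)
  \<comment> \<open>Since exp(2X) - 1 = (exp X - 1)(exp X + 1), this multiplication clears the
    denominators of both b(X) and b(2X).\<close>
  have "(b - b2) * (fps_exp 2 - 1) = b * (fps_exp 1 - 1) * (1 + fps_exp 1) - fps_const 2 * fps_X"
    using b2 by (simp add: algebra_simps ee)
  also have "\<dots> = fps_X * (fps_exp 1 - 1)"
    unfolding b by (simp add: algebra_simps fps_eq_iff)
  also have "\<dots> = fps_X * (g * (1 + fps_exp 1)) * (fps_exp 1 - 1)"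
    unfolding g by simp
  also have "\<dots> = (fps_X * g) * ((1 + fps_exp 1) * (fps_exp 1 - 1))"
    by (simp only: mult.assoc)
  also have "(1 + fps_exp 1) * (fps_exp 1 - 1) = (fps_exp 2 - 1 :: rat fps)"
    by (simp add: algebra_simps ee)
  finally have "(b - b2) * (fps_exp 2 - 1) = (fps_X * g) * (fps_exp 2 - 1)" .
  moreover have "fps_nth (fps_exp 2 - 1 :: rat fps) 1 \<noteq> fps_nth 0 1" by simp
  then have "fps_exp 2 - 1 \<noteq> (0 :: rat fps)" by metis
  ultimately have "b - b2 = fps_X * g" by simp
  then have "fps_nth (b - b2) (n + 2) = fps_nth g (Suc n)" by simp
  moreover have "fps_nth b (n + 2) = bernoulli (n + 2) / fact (n + 2)"
    unfolding bernoulli_def b_def by simp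
  moreover have "fps_nth b2 (n + 2) = 2 ^ (n + 2) * fps_nth b (n + 2)"
    unfolding b2_def by (rule fps_nth_compose_linear)
  ultimately have gn: "fps_nth g (Suc n) = (1 - 2 ^ (n + 2)) * bernoulli (n + 2) / fact (n + 2)"
    by (simp add: left_diff_distrib diff_divide_distrib del: fact_Suc)
  \<comment> \<open>The same coefficient read off from the iterated derivative: at X = 0, T = - exp
    X takes the value -1 and \<open>g\<close> the value 1/2.\<close>
  have "fact (Suc n) * fps_nth g (Suc n) = fps_nth (fps_nth_deriv (Suc n) g) 0"
    by (simp only: fps_deriv_maclauren_0 of_nat_fact)
  also have "fps_nth_deriv (Suc n) g = (- fps_exp 1) * eulerian (Suc n) (- fps_exp 1) * g ^ (n + 2)"
    by (rule fps_nth_deriv_eulerian) (use g in simp_all)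
  also have "fps_nth \<dots> 0 = - eulerian (Suc n) (- 1) / 2 ^ (n + 2)"
    by (simp add: fps_nth_eulerian_0 fps_nth_power_0 g_def power_divide)
  finally have "eulerian (Suc n) (- 1) = - (2 ^ (n + 2)) * (fact (Suc n) * fps_nth g (Suc n))"
    by (simp add: field_simps)
  also have "\<dots> = 2 ^ (n + 2) * (2 ^ (n + 2) - 1) * bernoulli (n + 2) * (fact (Suc n) / fact (n + 2))"
    unfolding gn by (simp only: divide_inverse algebra_simps)
  also have "fact (Suc n) / fact (n + 2) = (1 / of_nat (n + 2) :: rat)"
    using fact_Suc[of "Suc n", where ?'a = rat] by simp
  finally show ?thesis by simp
qed

subsection \<open>Multiples of powers of p and digits\<close>

text \<open>The ideal generated by p^k in the localization of the integers at p. Congruences become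
  memberships, which closure rules can prove.\<close>

definition p_multiples :: "nat \<Rightarrow> nat \<Rightarrow> rat set" where
  "p_multiples p k = (\<lambda>z. of_nat p ^ k * z) ` p_integers p"

lemma padic_cong_iff: "padic_cong p (p ^ k) x y \<longleftrightarrow> x - y \<in> p_multiples p k"
  by (auto simp: padic_cong_def p_multiples_def)

lemma p_multiples_0: "p_multiples p 0 = p_integers p"
  by (simp add: p_multiples_def)

lemma p_multiplesI: "z \<in> p_integers p \<Longrightarrow> of_nat p ^ k * z \<in> p_multiples p k"
  unfolding p_multiples_def by (rule imageI)

context
  fixes p :: nat
  assumes p: "prime p"
begin

lemma p_integers_of_nat: "of_nat n \<in> p_integers p"
  using of_int_in_p_integers[OF p, of "int n"] by simp

lemma p_integers_0: "0 \<in> p_integers p"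
  using p_integers_of_nat[of 0] by simp

lemma p_integers_1: "1 \<in> p_integers p"
  using p_integers_of_nat[of 1] by simp

lemma p_integers_uminus: "x \<in> p_integers p \<Longrightarrow> - x \<in> p_integers p"
  using p_integers_mult[OF p of_int_in_p_integers[OF p, of "-1"]] by simp

lemma p_integers_diff: "x \<in> p_integers p \<Longrightarrow> y \<in> p_integers p \<Longrightarrow> x - y \<in> p_integers p"
  using p_integers_add[OF p _ p_integers_uminus] by force

lemma p_integers_power: "x \<in> p_integers p \<Longrightarrow> x ^ n \<in> p_integers p"
  by (induction n) (auto intro: p_integers_1 p_integers_mult[OF p])

lemma p_integers_divide_nat:
  assumes "x \<in> p_integers p" "\<not> p dvd n"
  shows "x / of_nat n \<in> p_integers p"
proof -
  have "of_int 1 / of_int (int n) \<in> p_integers p"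
    by (rule p_integersI) (use assms in simp)
  from p_integers_mult[OF p assms(1) this] show ?thesis by simp
qed

lemma p_multiples_add:
  "x \<in> p_multiples p k \<Longrightarrow> y \<in> p_multiples p k \<Longrightarrow> x + y \<in> p_multiples p k"
  using p_integers_add[OF p] by (fastforce simp: p_multiples_def simp flip: distrib_left)

lemma p_multiples_uminus: "x \<in> p_multiples p k \<Longrightarrow> - x \<in> p_multiples p k"
  using p_integers_uminus by (fastforce simp: p_multiples_def simp flip: mult_minus_right)

lemma p_multiples_diff:
  "x \<in> p_multiples p k \<Longrightarrow> y \<in> p_multiples p k \<Longrightarrow> x - y \<in> p_multiples p k"
  using p_multiples_add[OF _ p_multiples_uminus, of x k y] by simp

lemma p_multiples_mult:
  assumes "x \<in> p_multiples p k" "y \<in> p_multiples p l"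
  shows "x * y \<in> p_multiples p (k + l)"
proof -
  obtain a b where "a \<in> p_integers p" "b \<in> p_integers p" "x = of_nat p ^ k * a" "y = of_nat p ^ l * b"
    using assms by (auto simp: p_multiples_def)
  moreover have "of_nat p ^ k * a * (of_nat p ^ l * b) = of_nat p ^ (k + l) * (a * b)"
    by (simp add: power_add)
  ultimately show ?thesis using p_multiplesI p_integers_mult[OF p] by metis
qed

lemma p_multiples_mult_left: "x \<in> p_integers p \<Longrightarrow> y \<in> p_multiples p k \<Longrightarrow> x * y \<in> p_multiples p k"
  using p_multiples_mult[of x 0 y k] by (simp add: p_multiples_0)

lemma p_multiples_mult_right: "x \<in> p_multiples p k \<Longrightarrow> y \<in> p_integers p \<Longrightarrow> x * y \<in> p_multiples p k"
  using p_multiples_mult[of x k y 0] by (simp add: p_multiples_0)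

lemma p_multiples_antimono:
  assumes "x \<in> p_multiples p k" "l \<le> k" shows "x \<in> p_multiples p l"
proof -
  obtain a where a: "a \<in> p_integers p" "x = of_nat p ^ k * a"
    using assms by (auto simp: p_multiples_def)
  have "x = of_nat p ^ l * (of_nat p ^ (k - l) * a)"
    unfolding a(2) using assms(2) by (simp flip: power_add)
  then show ?thesis
    using p_multiplesI p_integers_mult[OF p] p_integers_power p_integers_of_nat a(1) by metis
qed

lemma p_multiples_p_integers: "x \<in> p_multiples p k \<Longrightarrow> x \<in> p_integers p"
  using p_multiples_antimono[of x k 0] by (simp add: p_multiples_0)

lemma p_multiples_Suc_iff: "of_nat p * x \<in> p_multiples p (Suc k) \<longleftrightarrow> x \<in> p_multiples p k"
  using prime_gt_0_nat[OF p] by (auto simp: p_multiples_def image_iff)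

lemma p_multiples_sum:
  assumes "\<And>i. i \<in> I \<Longrightarrow> f i \<in> p_multiples p k"
  shows "sum f I \<in> p_multiples p k"
proof -
  have "0 \<in> p_multiples p k" using p_multiplesI[OF p_integers_0] by simp
  then show ?thesis using assms
    by (induction I rule: infinite_finite_induct) (auto intro: p_multiples_add)
qed

lemma p_integers_sum:
  assumes "\<And>i. i \<in> I \<Longrightarrow> f i \<in> p_integers p"
  shows "sum f I \<in> p_integers p"
  using p_multiples_sum[of I f 0] assms by (simp add: p_multiples_0)

lemma of_int_p_multiples_iff: "of_int u \<in> p_multiples p k \<longleftrightarrow> int p ^ k dvd u"
  using padic_cong_of_int_iff[OF p, of k u 0] by (simp add: padic_cong_iff cong_0_iff)

lemmas p_multiples_intros = p_integers_0 p_integers_1 p_integers_of_nat p_integers_uminus p_integers_diff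
  p_integers_add[OF p] p_integers_mult[OF p] p_integers_power
  p_multiples_add p_multiples_diff p_multiples_uminus

text \<open>Modulo p^2 the factor 1 + pz is a unit with inverse 1 - pz.\<close>

lemma p_multiples_cancel_unit:
  assumes x: "x \<in> p_integers p" and z: "z \<in> p_integers p"
  shows "x * (1 + of_nat p * z) \<in> p_multiples p 2 \<longleftrightarrow> x \<in> p_multiples p 2"
proof
  assume *: "x * (1 + of_nat p * z) \<in> p_multiples p 2"
  have "x = x * (1 + of_nat p * z) * (1 - of_nat p * z) + of_nat p ^ 2 * (x * z ^ 2)"
    by (simp add: algebra_simps power2_eq_square)
  also have "\<dots> \<in> p_multiples p 2"
    by (intro p_multiples_intros p_multiples_mult_right[OF *] p_multiplesI x z)
  finally show "x \<in> p_multiples p 2" .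
next
  assume "x \<in> p_multiples p 2"
  then show "x * (1 + of_nat p * z) \<in> p_multiples p 2"
    by (intro p_multiples_mult_right p_multiples_intros z)
qed

section \<open>The two leading p-adic digits\<close>

lemma padic_expansion_padic_digit:
  "x \<in> p_integers p \<Longrightarrow> is_padic_expansion p x (padic_digit p x)"
  unfolding padic_digit_def by (rule theI'[OF ex1_padic_expansion[OF p]])

lemma padic_digit_less: "x \<in> p_integers p \<Longrightarrow> padic_digit p x j < p"
  using padic_expansion_padic_digit padic_expansion_iff[OF p] by blast

lemma padic_digits_2:
  assumes "x \<in> p_integers p"
  shows "x - of_nat (padic_digit p x 0) - of_nat p * of_nat (padic_digit p x 1) \<in> p_multiples p 2"
proof -
  have "padic_cong p (p ^ 2) x (of_nat (\<Sum>j<2. padic_digit p x j * p ^ j))"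
    using padic_expansion_padic_digit[OF assms] padic_expansion_iff[OF p] by blast
  then show ?thesis unfolding padic_cong_iff by (simp add: numeral_2_eq_2 algebra_simps)
qed

text \<open>Two digit conditions become one congruence modulo p^2. The second digit is prescribed
  only modulo p, by an arbitrary p-integral \<open>y\<close> that need not be a digit
  itself.\<close>

lemma padic_digits_iff:
  assumes x: "x \<in> p_integers p" and y: "y \<in> p_integers p" and a: "a < p"
  shows "padic_digit p x 0 = a \<and> of_nat (padic_digit p x 1) - y \<in> p_multiples p 1
     \<longleftrightarrow> x - of_nat a - of_nat p * y \<in> p_multiples p 2"
proof -
  define d0 d1 where "d0 = padic_digit p x 0" and "d1 = padic_digit p x 1"
  have d: "x - of_nat d0 - of_nat p * of_nat d1 \<in> p_multiples p 2"
    unfolding d0_def d1_def by (rule padic_digits_2[OF x])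
  have d0: "d0 < p" unfolding d0_def by (rule padic_digit_less[OF x])
  have *: "x - of_nat d0 - of_nat p * y \<in> p_multiples p 2 \<longleftrightarrow> of_nat d1 - y \<in> p_multiples p 1"
  proof -
    have "of_nat d1 - y \<in> p_multiples p 1 \<longleftrightarrow> of_nat p * (of_nat d1 - y) \<in> p_multiples p 2"
      using p_multiples_Suc_iff[of "of_nat d1 - y" 1] by (simp add: numeral_2_eq_2)
    also have "\<dots> \<longleftrightarrow> x - of_nat d0 - of_nat p * y \<in> p_multiples p 2"
      using p_multiples_add[OF d, of "of_nat p * (of_nat d1 - y)"]
        p_multiples_diff[OF _ d, of "x - of_nat d0 - of_nat p * y"]
      by (auto simp: algebra_simps)
    finally show ?thesis by blast
  qed
  \<comment> \<open>Modulo p only \<open>d0 - a\<close> survives, and both numbers lie below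
    p.\<close>
  have "d0 = a" if "x - of_nat a - of_nat p * y \<in> p_multiples p 2"
  proof -
    have "(x - of_nat a - of_nat p * y) - (x - of_nat d0 - of_nat p * of_nat d1)
        + of_nat p ^ 1 * (y - of_nat d1) \<in> p_multiples p 1"
      by (intro p_multiples_intros p_multiplesI y p_multiples_antimono[OF that] p_multiples_antimono[OF d]) simp_all
    then have "of_int (int d0 - int a) \<in> p_multiples p 1" by (simp add: algebra_simps)
    from iffD1[OF of_int_p_multiples_iff this] have "int p dvd int d0 - int a" by simp
    then have "[int d0 = int a] (mod int p)" by (simp add: cong_iff_dvd_diff)
    then show ?thesis using d0 a by (simp add: cong_int_iff cong_less_modulus_unique_nat)
  qed
  then show ?thesis unfolding d0_def[symmetric] d1_def[symmetric] using * by auto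
qed

lemma padic_digits_eq_0_iff:
  assumes x: "x \<in> p_integers p"
  shows "padic_digit p x 0 = 0 \<and> padic_digit p x 1 = 0 \<longleftrightarrow> x \<in> p_multiples p 2"
proof -
  have "padic_digit p x 1 = 0 \<longleftrightarrow> of_nat (padic_digit p x 1) - 0 \<in> p_multiples p 1"
    using of_int_p_multiples_iff[of "int (padic_digit p x 1)" 1] padic_digit_less[OF x, of 1]
    by (auto dest: nat_dvd_not_less)
  then show ?thesis
    using padic_digits_iff[OF x, of 0 0] p_integers_0 prime_gt_0_nat[OF p] by simp
qed

text \<open>Any product of two or more of the terms p x_i disappears modulo p^2.\<close>

lemma prod_one_plus_p_mult:
  assumes "finite I" "\<And>i. i \<in> I \<Longrightarrow> x i \<in> p_integers p"
  shows "(\<Prod>i\<in>I. 1 + of_nat p * x i) - 1 - of_nat p * sum x I \<in> p_multiples p 2"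
  using assms
proof (induction I)
  case (insert i I)
  let ?P = "(\<Prod>i\<in>I. 1 + of_nat p * x i)"
  have "(\<Prod>i\<in>insert i I. 1 + of_nat p * x i) - 1 - of_nat p * sum x (insert i I)
     = (1 + of_nat p * x i) * (?P - 1 - of_nat p * sum x I) + of_nat p ^ 2 * (x i * sum x I)"
    using insert(1,2) by (simp add: algebra_simps power2_eq_square)
  also have "\<dots> \<in> p_multiples p 2"
    using insert by (intro p_multiples_intros p_multiples_mult_left[OF _ insert.IH] p_multiplesI p_integers_sum) auto
  finally show ?case .
qed (use p_multiplesI[OF p_integers_0] in simp)

end

context
  fixes p :: nat
  assumes p: "prime p" and odd: "odd p"
begin

lemma half_p_integers: "x \<in> p_integers p \<Longrightarrow> x / 2 \<in> p_integers p"
  using p_integers_divide_nat[OF p, of x 2] p odd primes_dvd_imp_eq[of p 2] by auto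

text \<open>The coefficient of p^2 is the second elementary symmetric polynomial, written by power
  sums; its division by 2 is where oddness of p enters.\<close>

lemma prod_one_plus_p_mult_2:
  assumes "finite I" "\<And>i. i \<in> I \<Longrightarrow> x i \<in> p_integers p"
  shows "(\<Prod>i\<in>I. 1 + of_nat p * x i) - 1 - of_nat p * sum x I
           - of_nat p ^ 2 * (((sum x I)\<^sup>2 - (\<Sum>i\<in>I. (x i)\<^sup>2)) / 2) \<in> p_multiples p 3"
  using assms
proof (induction I)
  case (insert i I)
  let ?P = "(\<Prod>i\<in>I. 1 + of_nat p * x i)" and ?s = "sum x I" and ?r = "(\<Sum>i\<in>I. (x i)\<^sup>2)"
  have "(\<Prod>i\<in>insert i I. 1 + of_nat p * x i) - 1 - of_nat p * sum x (insert i I)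
      - of_nat p ^ 2 * (((sum x (insert i I))\<^sup>2 - (\<Sum>i\<in>insert i I. (x i)\<^sup>2)) / 2)
     = (1 + of_nat p * x i) * (?P - 1 - of_nat p * ?s - of_nat p ^ 2 * ((?s\<^sup>2 - ?r) / 2))
       + of_nat p ^ 3 * (x i * ((?s\<^sup>2 - ?r) / 2))"
    using insert(1,2) by (simp add: field_simps power2_eq_square power3_eq_cube)
  also have "\<dots> \<in> p_multiples p 3"
    using insert by (intro p_multiples_intros[OF p] p_multiples_mult_left[OF p _ insert.IH] p_multiplesI
      p_integers_sum[OF p] half_p_integers) auto
  finally show ?case .
qed (use p_multiplesI[OF p_integers_0[OF p]] in simp)

end

subsection \<open>Congruences of Faulhaber, Glaisher and Wolstenholme\<close>

text \<open>Summing the geometric series gives b(X) (exp(mX) - 1) = X (1 + exp X + ... +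
  exp((m-1)X)), where b is the Bernoulli generating function; the claim compares the coefficients of
  X^(n+1). For n = 0 the summand k = 0 counts as 0^0 = 1.\<close>

lemma faulhaber:
  "of_nat (Suc n) * (\<Sum>k<m. of_nat k ^ n) =
     (\<Sum>i\<le>n. of_nat (Suc n choose i) * bernoulli i * of_nat m ^ (Suc n - i))"
proof -
  define b :: "rat fps" where "b = fps_X / (fps_exp 1 - 1)"
  have b: "b * (fps_exp 1 - 1) = fps_X" unfolding b_def by (rule bernoulli_fps)
  have bn: "fps_nth b i = bernoulli i / fact i" for i
    by (simp add: bernoulli_def b_def)
  have "b * (fps_exp (of_nat m) - 1) = b * (fps_exp 1 ^ m - 1)"
    by (simp add: fps_exp_power_mult)
  also have "\<dots> = b * (fps_exp 1 - 1) * (\<Sum>k<m. fps_exp 1 ^ k)"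
    by (simp only: power_diff_1_eq mult.assoc)
  also have "\<dots> = fps_X * (\<Sum>k<m. fps_exp (of_nat k))"
    by (simp add: b fps_exp_power_mult)
  finally have eq: "b * (fps_exp (of_nat m) - 1) = fps_X * (\<Sum>k<m. fps_exp (of_nat k))" .
  have "fact (Suc n) * fps_nth (fps_X * (\<Sum>k<m. fps_exp (of_nat k))) (Suc n)
      = (of_nat (Suc n) * (\<Sum>k<m. of_nat k ^ n) :: rat)"
    by (simp add: fps_sum_nth fact_Suc mult.assoc flip: sum_divide_distrib del: of_nat_Suc)
  moreover have "fact (Suc n) * fps_nth (b * (fps_exp (of_nat m) - 1)) (Suc n)
      = (\<Sum>i\<le>n. of_nat (Suc n choose i) * bernoulli i * of_nat m ^ (Suc n - i))"
  proof -
    \<comment> \<open>The summand \<open>i = Suc n\<close> of the Cauchy product vanishes, as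
      exp(mX) - 1 has no constant term.\<close>
    have "fps_nth (b * (fps_exp (of_nat m) - 1)) (Suc n)
        = (\<Sum>i\<le>n. bernoulli i / fact i * (of_nat m ^ (Suc n - i) / fact (Suc n - i)))"
      by (simp add: fps_mult_nth bn atLeast0AtMost del: fact_Suc) (intro sum.cong, auto simp: Suc_diff_le simp del: fact_Suc)
    then show ?thesis
      by (simp add: sum_distrib_left binomial_fact mult_ac del: fact_Suc)
  qed
  ultimately show ?thesis by (simp only: eq)
qed

context
  fixes p :: nat
  assumes p: "prime p" and odd: "odd p"
begin

lemma p_ge_3: "p \<ge> 3"
  using prime_gt_1_nat[OF p] odd by (cases "p = 2") auto

text \<open>The case m = 1 of \<open>faulhaber\<close> is the Bernoulli recurrence, which divides
  only by n + 1 < p.\<close>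

lemma bernoulli_p_integers:
  assumes "n < p - 1"
  shows "bernoulli n \<in> p_integers p"
  using assms
proof (induction n rule: less_induct)
  case (less n)
  have "(\<Sum>i\<le>n. of_nat (Suc n choose i) * bernoulli i) = (of_nat (Suc n) * 0 ^ n :: rat)"
    using faulhaber[of n 1] by simp
  moreover have "(\<Sum>i\<le>n. of_nat (Suc n choose i) * bernoulli i)
      = (\<Sum>i<n. of_nat (Suc n choose i) * bernoulli i) + of_nat (Suc n) * bernoulli n"
    by (simp add: lessThan_Suc_atMost[symmetric])
  ultimately have "bernoulli n = (of_nat (Suc n) * 0 ^ n
      - (\<Sum>i<n. of_nat (Suc n choose i) * bernoulli i)) / of_nat (Suc n)"
    by (simp add: field_simps del: of_nat_Suc)
  also have "\<dots> \<in> p_integers p"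
    using less by (intro p_integers_divide_nat[OF p] p_multiples_intros[OF p] p_integers_sum[OF p])
      (auto dest: dvd_imp_le)
  finally show ?case .
qed

text \<open>In p times the power sum, the summand i = p - 1 of \<open>faulhaber\<close> is p times p
  B. All others are divisible by p^3: for i = 0 by p^p with p at least 3, otherwise by one p from
  the binomial coefficient and at least p^2 from the power. One p is then cancelled.\<close>

lemma power_sum_bernoulli:
  "(\<Sum>k<p. of_nat k ^ (p - 1)) - of_nat p * bernoulli (p - 1) \<in> p_multiples p 2"
proof -
  let ?S = "\<Sum>k<p. of_nat k ^ (p - 1) :: rat"
  let ?f = "\<lambda>i. of_nat (p choose i) * bernoulli i * of_nat p ^ (p - i)"
  have Suc: "Suc (p - 1) = p" using p_ge_3 by simp
  have "{..p - 1} = insert (p - 1) {..<p - 1}" by auto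
  then have "of_nat p * ?S = ?f (p - 1) + (\<Sum>i<p - 1. ?f i)"
    using faulhaber[of "p - 1" p] unfolding Suc by simp
  also have "?f (p - 1) = of_nat p * (of_nat p * bernoulli (p - 1))"
    using p_ge_3 binomial_symmetric[of 1 p] by (simp add: Suc)
  finally have eq: "of_nat p * (?S - of_nat p * bernoulli (p - 1)) = (\<Sum>i<p - 1. ?f i)"
    by (simp add: algebra_simps)
  have "(\<Sum>i<p - 1. ?f i) \<in> p_multiples p (Suc 2)"
  proof (intro p_multiples_sum[OF p])
    fix i assume i: "i \<in> {..<p - 1}"
    have pw: "of_nat p ^ k * 1 \<in> p_multiples p l" if "l \<le> k" for k l
      using p_multiples_antimono[OF p p_multiplesI that] p_integers_1[OF p] by blast
    have bi: "bernoulli i \<in> p_integers p" using i by (intro bernoulli_p_integers) simp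
    show "?f i \<in> p_multiples p (Suc 2)"
    proof (cases "i = 0")
      case True
      then show ?thesis using p_multiples_mult_left[OF p bi pw[of "Suc 2" p]] p_ge_3 by simp
    next
      case False
      then have "p dvd (p choose i)" using i p by (intro dvd_choose_prime) auto
      then obtain c where c: "p choose i = p * c" by blast
      have "p - i = Suc (p - i - 1)" using i by auto
      then have "?f i = (of_nat c * bernoulli i) * (of_nat p ^ Suc (p - i) * 1)"
        by (simp add: c)
      also have "\<dots> \<in> p_multiples p (Suc 2)"
        using i by (intro p_multiples_mult_left[OF p] pw p_multiples_intros[OF p] bi) auto
      finally show ?thesis .
    qed
  qed
  then show ?thesis using p_multiples_Suc_iff[OF p] by (simp only: flip: eq)
qed

lemma fermat_quotient: "of_nat a ^ (p - 1) = 1 + of_nat p * fermat_quotient p a"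
  using p_ge_3 by (simp add: fermat_quotient_def)

lemma fermat_quotient_p_integers:
  assumes "\<not> p dvd a"
  shows "fermat_quotient p a \<in> p_integers p"
proof -
  have "[int (a ^ (p - 1)) = int 1] (mod int p)"
    using fermat_theorem[OF p assms] by (simp only: cong_int_iff)
  then obtain c where "int (a ^ (p - 1)) - int 1 = int p * c"
    by (auto simp: cong_iff_dvd_diff)
  then have "of_int (int (a ^ (p - 1)) - int 1) = (of_int (int p * c) :: rat)" by simp
  then have "fermat_quotient p a = of_int c"
    using p_ge_3 by (simp add: fermat_quotient_def)
  then show ?thesis by (simp add: of_int_in_p_integers[OF p])
qed

text \<open>Glaisher's congruence: both sides are governed by the sum of the Fermat quotients, which
  is the Wilson quotient modulo p (compare the (p - 1)-st power of (p - 1)!) and appears in the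
  power sum congruent to p B.\<close>

lemma glaisher:
  "agoh_giuga_quotient p \<in> p_integers p"
  "fact (p - 1) + 1 - of_nat p * (agoh_giuga_quotient p - 1) \<in> p_multiples p 2"
proof -
  let ?A = "agoh_giuga_quotient p"
  define Q where "Q = (\<Sum>k\<in>{1..p - 1}. fermat_quotient p k)"
  have q: "fermat_quotient p k \<in> p_integers p" if "k \<in> {1..p - 1}" for k
    using that by (intro fermat_quotient_p_integers) (auto dest: dvd_imp_le)
  have Q: "Q \<in> p_integers p"
    unfolding Q_def by (intro p_integers_sum[OF p] q)
  have p0: "of_nat p \<noteq> (0 :: rat)" using p_ge_3 by simp
  have pA: "of_nat p * ?A = of_nat p * bernoulli (p - 1) + 1"
    using p0 by (simp add: agoh_giuga_quotient_def)
  have "{..<p} = insert 0 {1..p - 1}" using p_ge_3 by auto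
  then have "(\<Sum>k<p. of_nat k ^ (p - 1)) = (\<Sum>k\<in>{1..p - 1}. 1 + of_nat p * fermat_quotient p k)"
    using p_ge_3 by (simp add: power_0_left flip: fermat_quotient)
  also have "\<dots> = of_nat p - 1 + of_nat p * Q"
    using p_ge_3 by (simp add: Q_def sum.distrib sum_distrib_left of_nat_diff)
  finally have S: "(\<Sum>k<p. of_nat k ^ (p - 1)) = of_nat p - 1 + of_nat p * Q" .
  \<comment> \<open>Cancelling p from the power sum congruence will show that \<open>1 + Q\<close>
    and \<open>?A\<close> agree modulo p.\<close>
  have "of_nat p * (1 + Q - ?A) = of_nat p - 1 + of_nat p * Q - of_nat p * bernoulli (p - 1)"
    unfolding right_diff_distrib distrib_left pA by simp
  then have "of_nat p * (1 + Q - ?A) \<in> p_multiples p (Suc 1)"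
    using power_sum_bernoulli unfolding S by (simp only: Suc_1)
  then have AQ: "1 + Q - ?A \<in> p_multiples p 1"
    by (simp only: p_multiples_Suc_iff[OF p])
  have "?A = 1 + Q - (1 + Q - ?A)" by simp
  also have "\<dots> \<in> p_integers p"
    by (intro p_multiples_intros[OF p] Q p_multiples_p_integers[OF p AQ])
  finally show A: "?A \<in> p_integers p" .
  have "[fact (p - 1) = - 1] (mod int p)" using wilson_theorem[OF p] .
  then obtain c where "fact (p - 1) - (- 1) = int p * c" by (auto simp: cong_iff_dvd_diff)
  then have "of_int (fact (p - 1) - (- 1)) = (of_int (int p * c) :: rat)" by simp
  then obtain w where w: "w \<in> p_integers p" and fact: "fact (p - 1) = - 1 + of_nat p * w"
    using of_int_in_p_integers[OF p, of c] by (auto simp: algebra_simps)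
  \<comment> \<open>Here \<open>w\<close> is the Wilson quotient. Both products are the (p - 1)-st
    power of (p - 1)!: \<open>?R\<close> by taking the powers of the factors k, \<open>?L\<close>
    from (p - 1)! = -(1 - pw) with p - 1 even. Their linear terms are pQ and -p(p - 1)w, and the
    latter is pw modulo p^2.\<close>
  let ?R = "(\<Prod>k\<in>{1..p - 1}. 1 + of_nat p * fermat_quotient p k)"
    and ?L = "(\<Prod>k\<in>{1..p - 1}. 1 + of_nat p * (- w))"
  have R: "?R - 1 - of_nat p * Q \<in> p_multiples p 2"
    unfolding Q_def using q by (intro prod_one_plus_p_mult[OF p]) auto
  have "?L - 1 - of_nat p * (\<Sum>k\<in>{1..p - 1}. - w) \<in> p_multiples p 2"
    using w by (intro prod_one_plus_p_mult[OF p] p_multiples_intros[OF p]) auto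
  then have L: "?L - 1 + of_nat p * (of_nat p - 1) * w \<in> p_multiples p 2"
    using p_ge_3 by (simp add: of_nat_diff algebra_simps)
  have "?L = (- 1) ^ (p - 1) * (1 - of_nat p * w) ^ (p - 1)"
    using odd by simp
  also have "\<dots> = fact (p - 1) ^ (p - 1)"
    unfolding fact by (simp add: flip: power_mult_distrib)
  also have "\<dots> = ?R"
    by (simp add: fact_prod prod_power_distrib of_nat_prod flip: fermat_quotient)
  finally have LR: "?L = ?R" .
  have "of_nat p * (w - Q) = (?R - 1 - of_nat p * Q) - (?L - 1 + of_nat p * (of_nat p - 1) * w)
      + of_nat p ^ 2 * w"
    unfolding LR by (simp add: algebra_simps power2_eq_square)
  also have "\<dots> \<in> p_multiples p 2"
    by (intro p_multiples_intros[OF p] R L p_multiplesI w)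
  finally have "of_nat p * (w - Q) \<in> p_multiples p 2" .
  moreover have "of_nat p * (1 + Q - ?A) \<in> p_multiples p 2"
    using AQ p_multiples_Suc_iff[OF p, of _ 1] by (simp add: numeral_2_eq_2)
  moreover have "fact (p - 1) + 1 - of_nat p * (?A - 1) = of_nat p * (w - Q) + of_nat p * (1 + Q - ?A)"
    unfolding fact by (simp add: algebra_simps)
  ultimately show "fact (p - 1) + 1 - of_nat p * (?A - 1) \<in> p_multiples p 2"
    using p_multiples_add[OF p] by metis
qed

text \<open>All is first multiplied by p - 1, which turns (p - 2)! into (p - 1)!, open to
  \<open>glaisher\<close>, and clears the denominator in \<open>eulerian_minus_1\<close>.\<close>

lemma two_num_even_ascents_cong:
  defines "q \<equiv> fermat_quotient p 2" and "A \<equiv> agoh_giuga_quotient p"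
    and "x \<equiv> of_nat (2 * num_even_ascents (p - 2)) :: rat"
  shows "x - 1 - of_nat p * (2 - A) - q * (1 + of_nat p * (1 - A + q)) \<in> p_multiples p 2"
proof -
  define P :: rat where "P = of_nat p"
  have P: "P \<ge> 3" using p_ge_3 unfolding P_def by simp
  have q: "q \<in> p_integers p"
    unfolding q_def using p_ge_3 by (intro fermat_quotient_p_integers) (auto dest: dvd_imp_le)
  have A: "A \<in> p_integers p" unfolding A_def by (rule glaisher)
  have x: "x \<in> p_integers p" unfolding x_def by (rule p_integers_of_nat[OF p])
  have q2: "2 ^ (p - 1) = 1 + P * q" using fermat_quotient[of 2] by (simp add: q_def P_def)
  have pA: "P * bernoulli (p - 1) = P * A - 1"
    using P by (simp add: A_def agoh_giuga_quotient_def P_def)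
  obtain e where e: "e \<in> p_integers p" "fact (p - 1) + 1 - P * (A - 1) = P ^ 2 * e"
    using glaisher(2) unfolding p_multiples_def A_def P_def by blast
  have fact: "(P - 1) * fact (p - 2) = fact (p - 1)"
    using p_ge_3 fact_reduce[of "p - 1", where ?'a = rat] by (simp add: P_def of_nat_diff numeral_2_eq_2)
  have "eulerian (p - 2) (- 1 :: rat) = 2 ^ (p - 1) * (2 ^ (p - 1) - 1) * bernoulli (p - 1) / (P - 1)"
  proof -
    \<comment> \<open>The index n = p - 3 brings in the Bernoulli number of index p - 1.\<close>
    have "Suc (p - 3) = p - 2" "p - 3 + 2 = p - 1" using p_ge_3 by simp_all
    moreover have "of_nat (p - 1) = P - 1" using p_ge_3 by (simp add: P_def of_nat_diff)
    ultimately show ?thesis using eulerian_minus_1[of "p - 3"] by (simp only:)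
  qed
  then have "(P - 1) * eulerian (p - 2) (- 1) = 2 ^ (p - 1) * (2 ^ (p - 1) - 1) * bernoulli (p - 1)"
    using P by simp
  then have eu: "(P - 1) * eulerian (p - 2) (- 1) = (1 + P * q) * q * (P * A - 1)"
    unfolding q2 pA[symmetric] by (simp only: add_diff_cancel_left' mult_ac)
  have "(P - 1) * x = fact (p - 1) + (1 + P * q) * q * (P * A - 1)"
    unfolding x_def two_num_even_ascents distrib_left fact eu by (rule refl)
  also have "fact (p - 1) = P ^ 2 * e - 1 + P * (A - 1)" using e(2) by (simp add: algebra_simps)
  finally have Px: "(P - 1) * x = P ^ 2 * e - 1 + P * (A - 1) + (1 + P * q) * q * (P * A - 1)" .
  \<comment> \<open>Modulo P^2 the inverse of P - 1 is -(1 + P).\<close>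
  have "x = P ^ 2 * x - (1 + P) * ((P - 1) * x)"
    by (simp add: algebra_simps power2_eq_square)
  then have "x - 1 - P * (2 - A) - q * (1 + P * (1 - A + q)) =
      P ^ 2 * x - (1 + P) * ((P - 1) * x) - 1 - P * (2 - A) - q * (1 + P * (1 - A + q))" by simp
  also have "\<dots> = P ^ 2 * (x + (1 - A) - (1 + P) * e + q * (q - A - q * A) - P * (q ^ 2 * A))"
    unfolding Px by (simp add: algebra_simps power2_eq_square)
  also have "\<dots> \<in> p_multiples p 2"
    unfolding P_def by (intro p_multiplesI p_multiples_intros[OF p] x A q e)
  finally show ?thesis by (simp add: P_def)
qed

end

section \<open>Half systems of residues, harmonic sums and the Fermat quotient of 2\<close>

lemma (in comm_monoid_set) split_reflect:
  "F g {1..2 * m :: nat} = F g {1..m} \<^bold>* F (\<lambda>j. g (2 * m + 1 - j)) {1..m}"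
proof -
  have "bij_betw (\<lambda>j. 2 * m + 1 - j) {1..m} {m + 1..2 * m}"
    by (rule bij_betwI[where g = "\<lambda>j. 2 * m + 1 - j"]) auto
  then have "F (\<lambda>j. g (2 * m + 1 - j)) {1..m} = F g {m + 1..2 * m}"
    by (rule reindex_bij_betw)
  moreover have "{1..2 * m} = {1..m} \<union> {m + 1..2 * m}" by auto
  ultimately show ?thesis by (simp add: union_disjoint)
qed

text \<open>With p = 2m + 1, subtraction from p exchanges the even and the odd numbers in 1, ..., p
  - 1.\<close>

lemma (in comm_monoid_set) odd_reflect:
  "F g {k \<in> {1..2 * m :: nat}. odd k} = F (\<lambda>j. g (2 * m + 1 - 2 * j)) {1..m}"
proof -
  have "bij_betw (\<lambda>j. 2 * m + 1 - 2 * j) {1..m} {k \<in> {1..2 * m}. odd k}"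
    by (rule bij_betwI[where g = "\<lambda>k. (2 * m + 1 - k) div 2"]) (auto elim!: oddE simp flip: diff_mult_distrib2)
  then show ?thesis by (rule reindex_bij_betw[symmetric])
qed

text \<open>Like \<open>split_reflect\<close>, this is proved for a general commutative operation
  because it is needed for harmonic sums as well as for the factorial.\<close>

lemma (in comm_monoid_set) split_parity:
  "F g {1..2 * m :: nat} = F (\<lambda>j. g (2 * j)) {1..m} \<^bold>* F (\<lambda>j. g (2 * m + 1 - 2 * j)) {1..m}"
proof -
  have "bij_betw (\<lambda>j. 2 * j) {1..m} {k \<in> {1..2 * m}. even k}"
    by (rule bij_betwI[where g = "\<lambda>k. k div 2"]) auto
  then have "F (\<lambda>j. g (2 * j)) {1..m} = F g {k \<in> {1..2 * m}. even k}"
    by (rule reindex_bij_betw)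
  moreover have "{1..2 * m} = {k \<in> {1..2 * m}. even k} \<union> {k \<in> {1..2 * m}. odd k}" by auto
  moreover have "F g ({k \<in> {1..2 * m}. even k} \<union> {k \<in> {1..2 * m}. odd k}) =
     F g {k \<in> {1..2 * m}. even k} \<^bold>* F g {k \<in> {1..2 * m}. odd k}"
    by (rule union_disjoint) auto
  ultimately show ?thesis by (simp only: odd_reflect)
qed

context
  fixes p m :: nat
  assumes p: "prime p" and pm: "p = 2 * m + 1"
begin

lemma odd_p: "odd p" by (simp add: pm)

lemma index_not_dvd:
  assumes "j \<in> {1..m}"
  shows "\<not> p dvd j" "\<not> p dvd p - j" "\<not> p dvd p - 2 * j"
  using assms pm by (auto dest!: dvd_imp_le)

lemma inverse_p_integers:
  assumes "j \<in> {1..m}"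
  shows "1 / of_nat j \<in> p_integers p"
    "1 / (of_nat p - of_nat j) \<in> p_integers p"
    "1 / (of_nat p - 2 * of_nat j) \<in> p_integers p"
  using index_not_dvd[OF assms, THEN p_integers_divide_nat[OF p p_integers_1[OF p]]] assms
  by (simp_all add: of_nat_diff pm)

lemma index_nonzero:
  assumes "j \<in> {1..m}"
  shows "of_nat j \<noteq> (0 :: rat)" "of_nat p - of_nat j \<noteq> (0 :: rat)"
    "of_nat p - 2 * of_nat j \<noteq> (0 :: rat)"
proof -
  have "of_nat (p - j) \<noteq> (0 :: rat)" "of_nat (p - 2 * j) \<noteq> (0 :: rat)"
    using assms pm by auto
  then show "of_nat p - of_nat j \<noteq> (0 :: rat)" "of_nat p - 2 * of_nat j \<noteq> (0 :: rat)"
    using assms pm by (auto simp: of_nat_diff)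
qed (use assms in simp)

text \<open>Writing the nonzero residues as j, p - j and as 2j, p - 2j shows that the sum of their
  inverse squares is both 2r and r/2, where r is the sum over the lower half.\<close>

lemma sum_inverse_squares:
  assumes "p \<noteq> 3"
  shows "(\<Sum>j\<in>{1..m}. (1 / of_nat j)\<^sup>2) \<in> p_multiples p 1"
proof -
  define P :: rat where "P = of_nat p"
  define g :: "nat \<Rightarrow> rat" where "g k = (1 / of_nat k)\<^sup>2" for k
  define r where "r = sum g {1..m}"
  have diff: "g (p - j) - g j \<in> p_multiples p 1" "g (p - 2 * j) - g (2 * j) \<in> p_multiples p 1"
    if j: "j \<in> {1..m}" for j
  proof -
    have half: "1 / (2 * of_nat j) \<in> p_integers p"
      using half_p_integers[OF p odd_p inverse_p_integers(1)[OF j]] by (simp add: mult.commute)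
    \<comment> \<open>The numerator x^2 - (P - x)^2 factors as P (2x - P).\<close>
    have *: "(1 / (P - x))\<^sup>2 - (1 / x)\<^sup>2 = P ^ 1 * ((1 / x)\<^sup>2 * ((1 / (P - x))\<^sup>2 * (2 * x - P)))"
      if "x \<noteq> 0" "P - x \<noteq> 0" for x
      using that by (simp add: divide_simps) (simp add: algebra_simps power2_eq_square)
    show "g (p - j) - g j \<in> p_multiples p 1"
    proof -
      have "g (p - j) - g j = (1 / (P - of_nat j))\<^sup>2 - (1 / of_nat j)\<^sup>2"
        using j by (simp add: g_def P_def pm of_nat_diff)
      also have "\<dots> \<in> p_multiples p 1"
        unfolding *[OF index_nonzero(1,2)[OF j, folded P_def]] unfolding P_def using p_integers_of_nat[OF p, of 2]
        by (intro p_multiplesI p_multiples_intros[OF p] inverse_p_integers j) simp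
      finally show ?thesis .
    qed
    show "g (p - 2 * j) - g (2 * j) \<in> p_multiples p 1"
    proof -
      have "g (p - 2 * j) - g (2 * j) = (1 / (P - 2 * of_nat j))\<^sup>2 - (1 / (2 * of_nat j))\<^sup>2"
        using j by (simp add: g_def P_def pm of_nat_diff)
      also have "\<dots> = P ^ 1 * ((1 / (2 * of_nat j))\<^sup>2 * ((1 / (P - 2 * of_nat j))\<^sup>2 * (2 * (2 * of_nat j) - P)))"
        using index_nonzero(1,3)[OF j] by (intro *) (simp_all add: P_def)
      also have "\<dots> \<in> p_multiples p 1"
        unfolding P_def using p_integers_of_nat[OF p, of 2]
        by (intro p_multiplesI p_multiples_intros[OF p] inverse_p_integers half j) simp_all
      finally show ?thesis .
    qed
  qed
  have "sum g {1..2 * m} - 2 * r = (\<Sum>j\<in>{1..m}. g (p - j) - g j)"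
    unfolding sum.split_reflect by (simp add: r_def sum_subtractf pm)
  also have "\<dots> \<in> p_multiples p 1" by (intro p_multiples_sum[OF p] diff)
  finally have 1: "sum g {1..2 * m} - 2 * r \<in> p_multiples p 1" .
  have "(\<Sum>j\<in>{1..m}. g (2 * j)) = r / 4"
    by (simp add: r_def g_def sum_divide_distrib power2_eq_square mult_ac)
  then have "sum g {1..2 * m} - r / 2 = (\<Sum>j\<in>{1..m}. g (p - 2 * j) - g (2 * j))"
    unfolding sum.split_parity by (simp add: sum_subtractf pm)
  also have "\<dots> \<in> p_multiples p 1" by (intro p_multiples_sum[OF p] diff)
  finally have 2: "sum g {1..2 * m} - r / 2 \<in> p_multiples p 1" .
  \<comment> \<open>The two evaluations 2r and r/2 differ by 3r/2, and 3 is invertible because p is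
    not 3.\<close>
  have "3 * r / 2 \<in> p_multiples p 1"
    using p_multiples_diff[OF p 2 1] by (simp add: algebra_simps)
  moreover have "2 / of_nat 3 \<in> p_integers p"
    using p_integers_of_nat[OF p, of 2] assms p primes_dvd_imp_eq[of p 3]
    by (intro p_integers_divide_nat[OF p]) auto
  ultimately have "2 / of_nat 3 * (3 * r / 2) \<in> p_multiples p 1"
    by (rule p_multiples_mult_left[OF p, rotated])
  then show ?thesis by (simp add: r_def g_def)
qed

text \<open>Pairing j with p - j gives 1/j + 1/(p - j), which is -p/j^2 modulo p^2; the inverse
  squares supply the second factor p. For p = 3 the sum is 3/2, which is not divisible by 9.\<close>

lemma wolstenholme:
  assumes "p \<noteq> 3"
  shows "(\<Sum>k\<in>{1..p - 1}. 1 / of_nat k) \<in> p_multiples p 2"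
proof -
  define P :: rat where "P = of_nat p"
  have "(\<Sum>k\<in>{1..2 * m}. 1 / of_nat k) = (\<Sum>j\<in>{1..m}. 1 / of_nat j + 1 / (P - of_nat j))"
    unfolding sum.split_reflect by (simp add: sum.distrib P_def pm of_nat_diff)
  also have "\<dots> = (\<Sum>j\<in>{1..m}. P ^ 2 * ((1 / of_nat j)\<^sup>2 * (1 / (P - of_nat j))) - P * (1 / of_nat j)\<^sup>2)"
  proof (intro sum.cong refl)
    fix j assume "j \<in> {1..m}"
    from index_nonzero(1,2)[OF this, folded P_def]
    show "1 / of_nat j + 1 / (P - of_nat j) =
        P ^ 2 * ((1 / of_nat j)\<^sup>2 * (1 / (P - of_nat j))) - P * (1 / of_nat j)\<^sup>2"
      by (simp add: divide_simps) (simp add: algebra_simps power2_eq_square)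
  qed
  also have "\<dots> = P ^ 2 * (\<Sum>j\<in>{1..m}. (1 / of_nat j)\<^sup>2 * (1 / (P - of_nat j)))
      - P * (\<Sum>j\<in>{1..m}. (1 / of_nat j)\<^sup>2)"
    by (simp only: sum_subtractf sum_distrib_left)
  also have "\<dots> \<in> p_multiples p 2"
  proof (rule p_multiples_diff[OF p])
    show "P ^ 2 * (\<Sum>j\<in>{1..m}. (1 / of_nat j)\<^sup>2 * (1 / (P - of_nat j))) \<in> p_multiples p 2"
      unfolding P_def by (intro p_multiplesI p_integers_sum[OF p] p_multiples_intros[OF p] inverse_p_integers)
    show "P * (\<Sum>j\<in>{1..m}. (1 / of_nat j)\<^sup>2) \<in> p_multiples p 2"
      using sum_inverse_squares[OF assms] p_multiples_Suc_iff[OF p, of _ 1]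
      by (simp add: P_def numeral_2_eq_2)
  qed
  finally show ?thesis by (simp add: pm)
qed

text \<open>Both factorizations of (p - 1)! are normalized by p - j = -j (1 - p/j) and p - 2j = -2j
  (1 - p/(2j)). One factor 2^m comes from the even numbers 2j, another from this
  normalization.\<close>

lemma prod_halved:
  "(\<Prod>j\<in>{1..m}. 1 + of_nat p * (- (1 / of_nat j))) =
     2 ^ (p - 1) * (\<Prod>j\<in>{1..m}. 1 + of_nat p * (- (1 / of_nat j) / 2 :: rat))"
proof -
  let ?X = "\<Prod>j\<in>{1..m}. 1 + of_nat p * (- (1 / of_nat j)) :: rat"
  let ?Y = "\<Prod>j\<in>{1..m}. 1 + of_nat p * (- (1 / of_nat j) / 2) :: rat"
  let ?D = "\<Prod>j\<in>{1..m}. - of_nat j :: rat" and ?J = "\<Prod>j\<in>{1..m}. of_nat j :: rat"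
  have J: "?J \<noteq> 0" and D: "?D \<noteq> 0" by simp_all
  have "?J * (\<Prod>j\<in>{1..m}. of_nat p - of_nat j) = (\<Prod>k\<in>{1..2 * m}. of_nat k)"
    unfolding prod.split_reflect by (simp add: pm of_nat_diff)
  also have "\<dots> = ?J * (2 ^ m * (\<Prod>j\<in>{1..m}. of_nat p - 2 * of_nat j))"
    unfolding prod.split_parity by (simp add: pm of_nat_diff prod.distrib)
  finally have "(\<Prod>j\<in>{1..m}. of_nat p - of_nat j) = (2 :: rat) ^ m * (\<Prod>j\<in>{1..m}. of_nat p - 2 * of_nat j)"
    using J by simp
  moreover have "(\<Prod>j\<in>{1..m}. of_nat p - of_nat j) = ?X * ?D"
    unfolding prod.distrib[symmetric] by (intro prod.cong) (auto simp: field_simps)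
  moreover have "(\<Prod>j\<in>{1..m}. of_nat p - 2 * of_nat j) = ?Y * (2 ^ m * ?D)"
  proof -
    have "2 ^ m = (\<Prod>j\<in>{1..m}. 2 :: rat)" by simp
    then show ?thesis
      by (simp only: prod.distrib[symmetric]) (intro prod.cong, auto simp: field_simps)
  qed
  ultimately have "?X * ?D = (2 ^ m * 2 ^ m * ?Y) * ?D" by (simp only: mult_ac)
  then have "?X = 2 ^ m * 2 ^ m * ?Y" using D by (simp only: mult_cancel_right) blast
  then show ?thesis by (simp only: pm mult_2 power_add add_diff_cancel_right')
qed

lemma odd_harmonic_eq:
  "odd_harmonic (p - 1) = (\<Sum>k\<in>{1..p - 1}. 1 / of_nat k) - (\<Sum>j\<in>{1..m}. 1 / of_nat j) / 2"
proof -
  have half: "(\<Sum>j\<in>{1..m}. 1 / of_nat (2 * j)) = (\<Sum>j\<in>{1..m}. 1 / of_nat j) / (2 :: rat)"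
    by (simp add: sum_divide_distrib mult.commute)
  have "p - 1 = 2 * m" by (simp add: pm)
  then show ?thesis
    by (simp only: odd_harmonic_def sum.split_parity sum.odd_reflect half add_diff_cancel_left')
qed

lemma odd_harmonic_p_integers: "odd_harmonic (p - 1) \<in> p_integers p"
  unfolding odd_harmonic_def
  by (intro p_integers_sum[OF p] p_integers_divide_nat[OF p] p_integers_1[OF p]) (auto dest: dvd_imp_le)

text \<open>As \<open>q\<close> enters with a factor p in 2^(p-1) = 1 + pq, the products are
  expanded modulo p^3 to determine it modulo p^2.\<close>

lemma fermat_quotient_2_iff_odd_harmonic:
  "fermat_quotient p 2 \<in> p_multiples p 2 \<longleftrightarrow> odd_harmonic (p - 1) \<in> p_multiples p 2"
proof (cases "p = 3")
  case True
  \<comment> \<open>The prime 3, excluded from \<open>wolstenholme\<close>, is checked directly: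
    both quantities are 1.\<close>
  have "{k \<in> {1..2 :: nat}. odd k} = {1}" by (auto simp: numeral_2_eq_2 le_Suc_eq)
  then have "odd_harmonic (p - 1) = 1" "fermat_quotient p 2 = 1"
    by (simp_all add: True odd_harmonic_def fermat_quotient_def)
  then show ?thesis by (simp only:)
next
  case False
  define P q :: rat where "P = of_nat p" and "q = fermat_quotient p 2"
  define h :: "nat \<Rightarrow> rat" where "h j = 1 / of_nat j" for j
  define s where "s = sum h {1..m}"
  have h: "h j \<in> p_integers p" if "j \<in> {1..m}" for j
    using inverse_p_integers(1)[OF that] by (simp add: h_def)
  have s: "s \<in> p_integers p" unfolding s_def by (intro p_integers_sum[OF p] h)
  have P: "P \<noteq> 0" by (simp add: P_def pm)
  have q: "q \<in> p_integers p"
    unfolding q_def using p_ge_3[OF p odd_p] by (intro fermat_quotient_p_integers[OF p odd_p]) (auto dest: dvd_imp_le)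
  have q2: "2 ^ (p - 1) = 1 + P * q" using fermat_quotient[OF p odd_p, of 2] by (simp add: q_def P_def)
  obtain \<rho> where \<rho>: "\<rho> \<in> p_integers p" "(\<Sum>j\<in>{1..m}. (h j)\<^sup>2) = P * \<rho>"
    using sum_inverse_squares[OF False] unfolding p_multiples_def h_def P_def by auto
  \<comment> \<open>To be used with c = -1 and c = -1/2, for the two products in
    \<open>prod_halved\<close>. The sum of squares is divisible by p, so its share of the quadratic
    term moves into the P^3 remainder.\<close>
  have expand: "\<exists>e\<in>p_integers p. (\<Prod>j\<in>{1..m}. 1 + P * (c * h j)) =
      1 + P * c * s + P ^ 2 * (c * s)\<^sup>2 / 2 + P ^ 3 * e" if c: "c \<in> p_integers p" for c
  proof -
    let ?X = "\<Prod>j\<in>{1..m}. 1 + P * (c * h j)"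
    have "?X - 1 - P * (\<Sum>j\<in>{1..m}. c * h j)
        - P ^ 2 * (((\<Sum>j\<in>{1..m}. c * h j)\<^sup>2 - (\<Sum>j\<in>{1..m}. (c * h j)\<^sup>2)) / 2) \<in> p_multiples p 3"
      unfolding P_def by (intro prod_one_plus_p_mult_2[OF p odd_p] p_integers_mult[OF p] c h) auto
    then obtain e where e: "e \<in> p_integers p" "?X - 1 - P * (\<Sum>j\<in>{1..m}. c * h j)
        - P ^ 2 * (((\<Sum>j\<in>{1..m}. c * h j)\<^sup>2 - (\<Sum>j\<in>{1..m}. (c * h j)\<^sup>2)) / 2) = P ^ 3 * e"
      unfolding p_multiples_def P_def by blast
    have "(\<Sum>j\<in>{1..m}. c * h j) = c * s" by (simp add: s_def sum_distrib_left)
    moreover have "(\<Sum>j\<in>{1..m}. (c * h j)\<^sup>2) = c ^ 2 * (P * \<rho>)"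
      by (simp only: power_mult_distrib sum_distrib_left[symmetric] \<rho>(2))
    ultimately have "?X = 1 + P * c * s + P ^ 2 * (c * s)\<^sup>2 / 2 + P ^ 3 * (e - c ^ 2 * \<rho> / 2)"
      using e(2) by (simp add: field_simps power2_eq_square power3_eq_cube)
    moreover have "e - c ^ 2 * \<rho> / 2 \<in> p_integers p"
      by (intro p_multiples_intros[OF p] half_p_integers[OF p odd_p] e \<rho> c)
    ultimately show ?thesis by blast
  qed
  have c1: "- 1 \<in> p_integers p" by (intro p_multiples_intros[OF p])
  have c2: "- 1 / 2 \<in> p_integers p" by (intro half_p_integers[OF p odd_p] c1)
  obtain e1 where e1: "e1 \<in> p_integers p" "(\<Prod>j\<in>{1..m}. 1 + P * (- h j)) =
      1 - P * s + P ^ 2 * s\<^sup>2 / 2 + P ^ 3 * e1"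
    using expand[OF c1] by (auto simp: algebra_simps)
  obtain e2 where e2: "e2 \<in> p_integers p" "(\<Prod>j\<in>{1..m}. 1 + P * (- h j / 2)) =
      1 - P * s / 2 + P ^ 2 * s\<^sup>2 / 8 + P ^ 3 * e2"
    using expand[OF c2] by (auto simp: power_divide power_mult_distrib)
  \<comment> \<open>Chosen so that 1 + Py is the expansion for c = -1/2.\<close>
  define y where "y = P * (s\<^sup>2 / 8 + P * e2) - s / 2"
  have e8: "s\<^sup>2 / 8 \<in> p_integers p"
    using half_p_integers[OF p odd_p half_p_integers[OF p odd_p half_p_integers[OF p odd_p
          p_integers_power[OF p s, of 2]]]] by simp
  have y: "y \<in> p_integers p"
    unfolding y_def P_def by (intro p_multiples_intros[OF p] half_p_integers[OF p odd_p] e8 e2 s)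
  have "1 - P * s + P ^ 2 * s\<^sup>2 / 2 + P ^ 3 * e1 = (1 + P * q) * (1 + P * y)"
    using prod_halved unfolding h_def[symmetric] P_def[symmetric] e1(2) e2(2) q2
    by (simp add: y_def algebra_simps power2_eq_square power3_eq_cube)
  then have "P * (q * (1 + P * y)) = 1 - P * s + P ^ 2 * s\<^sup>2 / 2 + P ^ 3 * e1 - (1 + P * y)"
    by (simp add: algebra_simps)
  \<comment> \<open>The quadratic coefficient 1/2 - 1/8 = 3/8 lets -s/2 be split off, with cofactor
    1 - 3Ps/4. Writing 3s/4 by halvings makes its integrality a matter of
    \<open>half_p_integers\<close>.\<close>
  also have "\<dots> = P * (- s / 2 * (1 + P * (- (s + s / 2) / 2)) + P ^ 2 * (e1 - e2))"
    by (simp add: y_def field_simps power2_eq_square power3_eq_cube)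
  finally have key: "q * (1 + P * y) = - s / 2 * (1 + P * (- (s + s / 2) / 2)) + P ^ 2 * (e1 - e2)"
    using P by simp
  have E: "P ^ 2 * (e1 - e2) \<in> p_multiples p 2"
    unfolding P_def by (intro p_multiplesI p_multiples_intros[OF p] e1 e2)
  have "q \<in> p_multiples p 2 \<longleftrightarrow> q * (1 + P * y) \<in> p_multiples p 2"
    unfolding P_def by (rule p_multiples_cancel_unit[OF p q y, symmetric])
  also have "\<dots> \<longleftrightarrow> - s / 2 * (1 + P * (- (s + s / 2) / 2)) \<in> p_multiples p 2"
    unfolding key using p_multiples_add[OF p _ E] p_multiples_diff[OF p _ E] by force
  also have "\<dots> \<longleftrightarrow> - s / 2 \<in> p_multiples p 2"
    unfolding P_def by (intro p_multiples_cancel_unit[OF p] half_p_integers[OF p odd_p] p_multiples_intros[OF p] s)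
  also have "\<dots> \<longleftrightarrow> odd_harmonic (p - 1) \<in> p_multiples p 2"
    using p_multiples_add[OF p wolstenholme[OF False], of "- s / 2"]
      p_multiples_diff[OF p _ wolstenholme[OF False], of "odd_harmonic (p - 1)"]
    unfolding odd_harmonic_eq s_def h_def by auto
  finally show ?thesis by (simp add: q_def)
qed

end

theorem theorem13:
  fixes p :: nat
  assumes "prime p" and "odd p"
  shows "(super_wieferich p \<longleftrightarrow>
            padic_digit p (of_nat (2 * num_even_ascents (p - 2))) 0 = 1 \<and>
            padic_cong p p (of_nat (padic_digit p (of_nat (2 * num_even_ascents (p - 2))) 1)
                            + agoh_giuga_quotient p) 2) \<and>
         (padic_digit p (of_nat (2 * num_even_ascents (p - 2))) 0 = 1 \<and>
            padic_cong p p (of_nat (padic_digit p (of_nat (2 * num_even_ascents (p - 2))) 1)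
                            + agoh_giuga_quotient p) 2 \<longleftrightarrow>
          padic_digit p (odd_harmonic (p - 1)) 0 = 0 \<and>
          padic_digit p (odd_harmonic (p - 1)) 1 = 0)"
proof -
  note p = assms(1) and odd = assms(2)
  obtain m where pm: "p = 2 * m + 1" using odd by (elim oddE)
  define x :: rat where "x = of_nat (2 * num_even_ascents (p - 2))"
  define q where "q = fermat_quotient p 2"
  define A where "A = agoh_giuga_quotient p"
  have q: "q \<in> p_integers p"
    unfolding q_def using p_ge_3[OF p odd] by (intro fermat_quotient_p_integers[OF p odd]) (auto dest: dvd_imp_le)
  have A: "A \<in> p_integers p" unfolding A_def by (rule glaisher[OF p odd])
  have x: "x \<in> p_integers p" unfolding x_def by (rule p_integers_of_nat[OF p])
  have two: "2 \<in> p_integers p" using p_integers_of_nat[OF p, of 2] by simp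
  \<comment> \<open>Each of the three conditions is reduced to this divisibility of
    \<open>q\<close>.\<close>
  have a: "super_wieferich p \<longleftrightarrow> q \<in> p_multiples p 2"
    by (simp add: super_wieferich_def p q_def padic_cong_iff)
  have "padic_cong p p (of_nat (padic_digit p x 1) + A) 2
      \<longleftrightarrow> of_nat (padic_digit p x 1) - (2 - A) \<in> p_multiples p 1"
    using padic_cong_iff[of p 1] by (simp add: algebra_simps)
  \<comment> \<open>\<open>padic_digits_iff\<close> with leading digit 1 and the p-integral value
    \<open>2 - A\<close> for the second digit.\<close>
  then have "padic_digit p x 0 = 1 \<and> padic_cong p p (of_nat (padic_digit p x 1) + A) 2
      \<longleftrightarrow> x - 1 - of_nat p * (2 - A) \<in> p_multiples p 2"
    using padic_digits_iff[OF p x p_integers_diff[OF p two A] prime_gt_1_nat[OF p]] by simp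
  also have "\<dots> \<longleftrightarrow> q * (1 + of_nat p * (1 - A + q)) \<in> p_multiples p 2"
    using two_num_even_ascents_cong[OF p odd, folded x_def A_def q_def]
    by (metis p_multiples_diff[OF p] diff_diff_eq2 add_diff_cancel_left' diff_add_cancel p_multiples_add[OF p])
  also have "\<dots> \<longleftrightarrow> q \<in> p_multiples p 2"
    by (intro p_multiples_cancel_unit[OF p] p_multiples_intros[OF p] q A)
  finally have b: "padic_digit p x 0 = 1 \<and> padic_cong p p (of_nat (padic_digit p x 1) + A) 2
      \<longleftrightarrow> q \<in> p_multiples p 2" .
  have c: "padic_digit p (odd_harmonic (p - 1)) 0 = 0 \<and> padic_digit p (odd_harmonic (p - 1)) 1 = 0
      \<longleftrightarrow> q \<in> p_multiples p 2"
    using padic_digits_eq_0_iff[OF p odd_harmonic_p_integers[OF p pm]]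
      fermat_quotient_2_iff_odd_harmonic[OF p pm] by (simp add: q_def)
  show ?thesis
    unfolding x_def[symmetric] A_def[symmetric] a b c by simp
qed

end
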